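(* For every bounded first-order language $\mathcal{L}$ (and every choice of the base total orders $\le_{\mathcal{L}_A}$), the function $c_{\mathcal{L}}$ is a canonicalization with respect to subsumption-equivalence $\equiv_{\sqsubseteq_{\mathcal{L}}}$, i.e., for all $\phi,\psi\in\mathcal{L}$: $c_{\mathcal{L}}(\phi)\equiv_{\sqsubseteq_{\mathcal{L}}}\phi$, and $\phi\equiv_{\sqsubseteq_{\mathcal{L}}}\psi$ iff $c_{\mathcal{L}}(\phi)=c_{\mathcal{L}}(\psi)$. Moreover, $\sqsubseteq_{\mathcal{L}}$ is a partial order on the set of canonical $\mathcal{L}$-formulas (those $\phi$ with $c_{\mathcal{L}}(\phi)=\phi$), and $\le_{\mathcal{L}}$ is a total order on the canonical $\mathcal{L}$-formulas that extends $\sqsubseteq_{\mathcal{L}}$.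
   Context: Fix a first-order signature $\Sigma$ and a set of variables $V$. For a finite $X\subseteq V$, $\mathfrak{S}_X$ is the set of permutations of $X$, and $\phi\pi$ denotes the formula obtained by substituting each free variable $x\in X$ of $\phi$ by $\pi(x)$. A set $F$ of formulas is $\mathfrak{S}_V$-closed if $\phi\pi\in F$ whenever $\phi\in F$ and $\pi$ permutes a finite subset of $V$. For a sequence $\bar\phi=\langle\phi_1,\dots,\phi_n\rangle$: $|\bar\phi|=n$, $[\bar\phi]=\{1,\dots,n\}$, $\phi_{-i}=\phi_{n-i+1}$, $\epsilon$ is the empty sequence, $\mathcal{L}^*$ is the set of finite sequences over $\mathcal{L}$. Bounded first-order languages (each with designated $\bot_{\mathcal{L}}$) are defined inductively ($X\subseteq V$ finite): $\mathcal{L}_A=A\cup\{\bot\}$ with $\bot_{\mathcal{L}_A}=\bot$ ($A$ any finite $\mathfrak{S}_V$-closed set of formulas over $\Sigma$ with free variables in $V$; $\bot$ is the false formula); $\mathcal{L}_1\vee\mathcal{L}_2=\{\phi_1\vee\phi_2\}$, $\mathcal{L}_1\wedge\mathcal{L}_2=\{\phi_1\wedge\phi_2\}$ ($\phi_i\in\mathcal{L}_i$), bottoms $\bot_{\mathcal{L}_1}\vee\bot_{\mathcal{L}_2}$, $\bot_{\mathcal{L}_1}\wedge\bot_{\mathcal{L}_2}$; $\bigvee_k\mathcal{L}=\{\bigvee\bar\phi\mid\bar\phi\in\mathcal{L}^*,|\bar\phi|\le k\}$ with bottom $\bigvee\epsilon$; $\bigwedge_\omega\mathcal{L}=\{\bigwedge\bar\phi\mid\bar\phi\in\mathcal{L}^*\setminus\{\epsilon\}\}$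 with bottom $\bigwedge\langle\bot_{\mathcal{L}}\rangle$; $\exists_X\mathcal{L}=\{\exists X.\phi\}$, $\forall_X\mathcal{L}=\{\forall X.\phi\}$ with bottoms $\exists X.\bot_{\mathcal{L}}$, $\forall X.\bot_{\mathcal{L}}$; $\exists\forall_X\mathcal{L}=\{QX.\phi\mid Q\in\{\exists,\forall\}\}$ with bottom $\forall X.\bot_{\mathcal{L}}$ ($\phi\in\mathcal{L}$). These are syntactic constructions. Subsumption $\sqsubseteq_{\mathcal{L}}$: $\phi\sqsubseteq_{\mathcal{L}_A}\psi$ iff $\phi=\bot$ or $\phi=\psi$; for $\circ\in\{\vee,\wedge\}$, $\phi_1\circ\phi_2\sqsubseteq\psi_1\circ\psi_2$ iff $\phi_1\sqsubseteq_{\mathcal{L}_1}\psi_1$ and $\phi_2\sqsubseteq_{\mathcal{L}_2}\psi_2$; $\bigvee\bar\phi\sqsubseteq_{\bigvee_k\mathcal{L}}\bigvee\bar\psi$ iff there is an injective $m:[\bar\phi]\to[\bar\psi]$ with $\phi_i\sqsubseteq_{\mathcal{L}}\psi_{m(i)}$ for all $i$; $\bigwedge\bar\phi\sqsubseteq_{\bigwedge_\omega\mathcal{L}}\bigwedge\bar\psi$ iff there is $m:[\bar\psi]\to[\bar\phi]$ with $\phi_{m(i)}\sqsubseteq_{\mathcal{L}}\psi_i$ for all $i$; for $Q\in\{\exists,\forall\}$, $QX.\phi\sqsubseteq_{Q_X\mathcal{L}}QX.\psi$ iff $\phi\sqsubseteq_{\mathcal{L}}\psi\pi$ for some $\pi\in\mathfrak{S}_X$;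 $QX.\phi\sqsubseteq_{\exists\forall_X\mathcal{L}}Q'X.\psi$ iff $\phi\sqsubseteq_{\mathcal{L}}\psi\pi$ for some $\pi\in\mathfrak{S}_X$ and ($Q=\forall$ or $Q'=\exists$). Subsumption-equivalence: $\phi\equiv_{\sqsubseteq_{\mathcal{L}}}\psi$ iff $\phi\sqsubseteq_{\mathcal{L}}\psi$ and $\psi\sqsubseteq_{\mathcal{L}}\phi$. Notation: for a set $F$ of canonical formulas, $\min_{\sqsubseteq_{\mathcal{L}}}F=\{\phi\in F\mid\forall\psi\in F\setminus\{\phi\}.\ \psi\not\sqsubseteq_{\mathcal{L}}\phi\}$; $\min_{\le_{\mathcal{L}}}F$ is the $\le_{\mathcal{L}}$-least element of nonempty $F$; $\mathrm{sort}_{\le}(\cdot)$ is the sequence sorted ascending by $\le$; $\phi<\psi$ means $\phi\le\psi$ and $\phi\neq\psi$. The canonicalization $c_{\mathcal{L}}$ and the order $\le_{\mathcal{L}}$ on canonical formulas are defined by mutual induction ($\circ\in\{\vee,\wedge\}$, $Q\in\{\exists,\forall\}$): $c_{\mathcal{L}_A}(\phi)=\phi$; $c(\phi_1\circ\phi_2)=c_{\mathcal{L}_1}(\phi_1)\circ c_{\mathcal{L}_2}(\phi_2)$; $c_{\bigvee_k\mathcal{L}}(\bigvee\bar\phi)=\bigvee\mathrm{sort}_{\le_{\mathcal{L}}}\langle c_{\mathcal{L}}(\phi_1),\dots,c_{\mathcal{L}}(\phi_n)\rangle$; $c_{\bigwedge_\omega\mathcal{L}}(\bigwedge\bar\phi)=\bigwedge\mathrm{sort}_{\le_{\mathcal{L}}}(\min_{\sqsubseteq_{\mathcal{L}}}\{c_{\mathcal{L}}(\phi_1),\dots,c_{\mathcal{L}}(\phi_n)\})$;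 $c_{Q_X\mathcal{L}}(QX.\phi)=QX.\min_{\le_{\mathcal{L}}}\{c_{\mathcal{L}}(\phi\pi)\mid\pi\in\mathfrak{S}_X\}$; $c_{\exists\forall_X\mathcal{L}}(QX.\phi)=c_{Q_X\mathcal{L}}(QX.\phi)$. $\le_{\mathcal{L}_A}$ is an arbitrary total order on $\mathcal{L}_A$ extending $\sqsubseteq_{\mathcal{L}_A}$; $\phi_1\circ\phi_2\le\psi_1\circ\psi_2$ iff $\phi_1<_{\mathcal{L}_1}\psi_1$, or $\phi_1=\psi_1$ and $\phi_2\le_{\mathcal{L}_2}\psi_2$; $\bigvee\bar\phi\le_{\bigvee_k\mathcal{L}}\bigvee\bar\psi$ iff $\bar\phi$ is a suffix of $\bar\psi$, or there is $i\in[\bar\phi]\cap[\bar\psi]$ with $\phi_{-i}<_{\mathcal{L}}\psi_{-i}$ and $\phi_{-j}=\psi_{-j}$ for all $j<i$; $\bigwedge\bar\phi\le_{\bigwedge_\omega\mathcal{L}}\bigwedge\bar\psi$ iff $\bar\psi$ is a prefix of $\bar\phi$, or there is $i\in[\bar\phi]\cap[\bar\psi]$ with $\phi_i<_{\mathcal{L}}\psi_i$ and $\phi_j=\psi_j$ for all $j<i$; $QX.\phi\le_{Q_X\mathcal{L}}QX.\psi$ iff $\phi\le_{\mathcal{L}}\psi$; $QX.\phi\le_{\exists\forall_X\mathcal{L}}Q'X.\psi$ iff ($Q=Q'$ and $\phi\le_{\mathcal{L}}\psi$) or ($Q=\forall$ and $Q'=\exists$).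
   Formalization: For the quantified languages over X it is also required that no permutation of X sends a free variable of a formula of the inner language into an inner quantifier block that captures it; without this the claim fails, e.g. for ∃_{x,y}∀_{y} over A={r(x),r(y)}. *)

theory Defs
  imports Main "HOL-Library.Multiset" "HOL-Library.Sublist" "HOL-Combinatorics.Permutations"
begin

record ('f, 'p) signature =
  fun_arity :: "'f \<Rightarrow> nat option"
  rel_arity :: "'p \<Rightarrow> nat option"

text \<open>
  Ordinary first-order formulas, from which base languages are drawn. Free variables are named,
  variables bound by a quantifier are de Bruijn indices (so formulas are identified up to renaming
  of bound variables). The set function \<open>fo_vars\<close> therefore yields exactly the free variables, and
  the map function \<open>fo_rename\<close> is capture-avoiding substitution of variables for free variables.
\<close>

datatype (dead 'f, tm_vars: 'v) tm =
    Var 'v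
  | Bound nat
  | App 'f "('f, 'v) tm list"
  for map: tm_rename

datatype (dead 'f, dead 'p, fo_vars: 'v) fo =
    Falsum
  | Equal "('f, 'v) tm" "('f, 'v) tm"
  | Rel 'p "('f, 'v) tm list"
  | Neg "('f, 'p, 'v) fo"
  | Disj "('f, 'p, 'v) fo" "('f, 'p, 'v) fo"
  | Conj "('f, 'p, 'v) fo" "('f, 'p, 'v) fo"
  | Impl "('f, 'p, 'v) fo" "('f, 'p, 'v) fo"
  | Exi "('f, 'p, 'v) fo"
  | Uni "('f, 'p, 'v) fo"
  for map: fo_rename

fun wf_tm :: "('f, 'p) signature \<Rightarrow> nat \<Rightarrow> ('f, 'v) tm \<Rightarrow> bool" where
  "wf_tm \<Sigma> n (Var x) \<longleftrightarrow> True"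
| "wf_tm \<Sigma> n (Bound i) \<longleftrightarrow> i < n"
| "wf_tm \<Sigma> n (App f ts) \<longleftrightarrow> fun_arity \<Sigma> f = Some (length ts) \<and> (\<forall>t\<in>set ts. wf_tm \<Sigma> n t)"

text \<open>\<open>wf_fo \<Sigma> n \<phi>\<close>: \<open>\<phi>\<close> is over \<open>\<Sigma>\<close> and its dangling indices are below \<open>n\<close>.\<close>

fun wf_fo :: "('f, 'p) signature \<Rightarrow> nat \<Rightarrow> ('f, 'p, 'v) fo \<Rightarrow> bool" where
  "wf_fo \<Sigma> n Falsum \<longleftrightarrow> True"
| "wf_fo \<Sigma> n (Equal s t) \<longleftrightarrow> wf_tm \<Sigma> n s \<and> wf_tm \<Sigma> n t"
| "wf_fo \<Sigma> n (Rel r ts) \<longleftrightarrow> rel_arity \<Sigma> r = Some (length ts) \<and> (\<forall>t\<in>set ts. wf_tm \<Sigma> n t)"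
| "wf_fo \<Sigma> n (Neg \<phi>) \<longleftrightarrow> wf_fo \<Sigma> n \<phi>"
| "wf_fo \<Sigma> n (Disj \<phi> \<psi>) \<longleftrightarrow> wf_fo \<Sigma> n \<phi> \<and> wf_fo \<Sigma> n \<psi>"
| "wf_fo \<Sigma> n (Conj \<phi> \<psi>) \<longleftrightarrow> wf_fo \<Sigma> n \<phi> \<and> wf_fo \<Sigma> n \<psi>"
| "wf_fo \<Sigma> n (Impl \<phi> \<psi>) \<longleftrightarrow> wf_fo \<Sigma> n \<phi> \<and> wf_fo \<Sigma> n \<psi>"
| "wf_fo \<Sigma> n (Exi \<phi>) \<longleftrightarrow> wf_fo \<Sigma> (Suc n) \<phi>"
| "wf_fo \<Sigma> n (Uni \<phi>) \<longleftrightarrow> wf_fo \<Sigma> (Suc n) \<phi>"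

definition fo_formulas :: "('f, 'p) signature \<Rightarrow> 'v set \<Rightarrow> ('f, 'p, 'v) fo set" where
  "fo_formulas \<Sigma> V = {\<phi>. wf_fo \<Sigma> 0 \<phi> \<and> fo_vars \<phi> \<subseteq> V}"

definition perm_closed :: "'v set \<Rightarrow> ('f, 'p, 'v) fo set \<Rightarrow> bool" where
  "perm_closed V F \<longleftrightarrow>
     (\<forall>X \<pi> \<phi>. finite X \<and> X \<subseteq> V \<and> \<pi> permutes X \<and> \<phi> \<in> F \<longrightarrow> fo_rename \<pi> \<phi> \<in> F)"

definition base_set :: "('f, 'p) signature \<Rightarrow> 'v set \<Rightarrow> ('f, 'p, 'v) fo set \<Rightarrow> bool" where
  "base_set \<Sigma> V A \<longleftrightarrow> finite A \<and> A \<subseteq> fo_formulas \<Sigma> V \<and> perm_closed V A"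

datatype connective = Or | And
datatype quantifier = Exists | Forall

text \<open>Formulas built by the language constructors; they are not identified up to anything.\<close>

datatype (dead 'f, dead 'p, dead 'v) fm =
    Base "('f, 'p, 'v) fo"
  | Bin connective "('f, 'p, 'v) fm" "('f, 'p, 'v) fm"
  | BigOr "('f, 'p, 'v) fm list"
  | BigAnd "('f, 'p, 'v) fm list"
  | Quant quantifier "'v set" "('f, 'p, 'v) fm"

fun fv :: "('f, 'p, 'v) fm \<Rightarrow> 'v set" where
  "fv (Base a) = fo_vars a"
| "fv (Bin c \<phi> \<psi>) = fv \<phi> \<union> fv \<psi>"
| "fv (BigOr \<phi>s) = (\<Union>\<phi>\<in>set \<phi>s. fv \<phi>)"
| "fv (BigAnd \<phi>s) = (\<Union>\<phi>\<in>set \<phi>s. fv \<phi>)"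
| "fv (Quant q Y \<phi>) = fv \<phi> - Y"

text \<open>Literal substitution of \<open>\<pi> x\<close> for every free \<open>x\<close>; it is meaningful where \<open>capture_free\<close> holds.\<close>

fun subst :: "('v \<Rightarrow> 'v) \<Rightarrow> ('f, 'p, 'v) fm \<Rightarrow> ('f, 'p, 'v) fm" where
  "subst \<pi> (Base a) = Base (fo_rename \<pi> a)"
| "subst \<pi> (Bin c \<phi> \<psi>) = Bin c (subst \<pi> \<phi>) (subst \<pi> \<psi>)"
| "subst \<pi> (BigOr \<phi>s) = BigOr (map (subst \<pi>) \<phi>s)"
| "subst \<pi> (BigAnd \<phi>s) = BigAnd (map (subst \<pi>) \<phi>s)"
| "subst \<pi> (Quant q Y \<phi>) = Quant q Y (subst (override_on \<pi> id Y) \<phi>)"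

text \<open>
  No free variable is sent to a variable that the enclosing block binds (``the substitution is free
  for the formula''). In the base case there is nothing to require, as bound variables are nameless.
\<close>

fun capture_free :: "('v \<Rightarrow> 'v) \<Rightarrow> ('f, 'p, 'v) fm \<Rightarrow> bool" where
  "capture_free \<pi> (Base a) \<longleftrightarrow> True"
| "capture_free \<pi> (Bin c \<phi> \<psi>) \<longleftrightarrow> capture_free \<pi> \<phi> \<and> capture_free \<pi> \<psi>"
| "capture_free \<pi> (BigOr \<phi>s) \<longleftrightarrow> (\<forall>\<phi>\<in>set \<phi>s. capture_free \<pi> \<phi>)"
| "capture_free \<pi> (BigAnd \<phi>s) \<longleftrightarrow> (\<forall>\<phi>\<in>set \<phi>s. capture_free \<pi> \<phi>)"
| "capture_free \<pi> (Quant q Y \<phi>) \<longleftrightarrow>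
     (\<forall>x \<in> fv \<phi> - Y. \<pi> x \<notin> Y) \<and> capture_free (override_on \<pi> id Y) \<phi>"

datatype (dead 'f, dead 'p, dead 'v) lang =
    LBase "('f, 'p, 'v) fo set"
  | LBin connective "('f, 'p, 'v) lang" "('f, 'p, 'v) lang"
  | LBigOr nat "('f, 'p, 'v) lang"
  | LBigAnd "('f, 'p, 'v) lang"
  | LQuant quantifier "'v set" "('f, 'p, 'v) lang"
  | LExistsForall "'v set" "('f, 'p, 'v) lang"

primrec formulas :: "('f, 'p, 'v) lang \<Rightarrow> ('f, 'p, 'v) fm set" where
  "formulas (LBase A) = Base ` insert Falsum A"
| "formulas (LBin c L1 L2) = {Bin c \<phi>1 \<phi>2 | \<phi>1 \<phi>2. \<phi>1 \<in> formulas L1 \<and> \<phi>2 \<in> formulas L2}"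
| "formulas (LBigOr k L) = {BigOr \<phi>s | \<phi>s. \<phi>s \<in> lists (formulas L) \<and> length \<phi>s \<le> k}"
| "formulas (LBigAnd L) = {BigAnd \<phi>s | \<phi>s. \<phi>s \<in> lists (formulas L) \<and> \<phi>s \<noteq> []}"
| "formulas (LQuant q X L) = {Quant q X \<phi> | \<phi>. \<phi> \<in> formulas L}"
| "formulas (LExistsForall X L) = {Quant q X \<phi> | q \<phi>. \<phi> \<in> formulas L}"

text \<open>
  The substitutions \<open>\<phi>\<pi>\<close> of block variables, on which subsumption and canonicalization of quantified
  formulas rest, must not be captured by an inner block; otherwise \<open>\<phi>\<pi>\<close> need not be a formula of the
  language. This always holds if the quantifier blocks nested inside the block are disjoint from it.
\<close>

definition substitutable :: "'v set \<Rightarrow> ('f, 'p, 'v) fm set \<Rightarrow> bool" where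
  "substitutable X F \<longleftrightarrow> (\<forall>\<pi> \<phi>. \<pi> permutes X \<and> \<phi> \<in> F \<longrightarrow> capture_free \<pi> \<phi>)"

primrec bounded_lang :: "('f, 'p) signature \<Rightarrow> 'v set \<Rightarrow> ('f, 'p, 'v) lang \<Rightarrow> bool" where
  "bounded_lang \<Sigma> V (LBase A) \<longleftrightarrow> base_set \<Sigma> V A"
| "bounded_lang \<Sigma> V (LBin c L1 L2) \<longleftrightarrow> bounded_lang \<Sigma> V L1 \<and> bounded_lang \<Sigma> V L2"
| "bounded_lang \<Sigma> V (LBigOr k L) \<longleftrightarrow> bounded_lang \<Sigma> V L"
| "bounded_lang \<Sigma> V (LBigAnd L) \<longleftrightarrow> bounded_lang \<Sigma> V L"
| "bounded_lang \<Sigma> V (LQuant q X L) \<longleftrightarrow>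
     bounded_lang \<Sigma> V L \<and> finite X \<and> X \<subseteq> V \<and> substitutable X (formulas L)"
| "bounded_lang \<Sigma> V (LExistsForall X L) \<longleftrightarrow>
     bounded_lang \<Sigma> V L \<and> finite X \<and> X \<subseteq> V \<and> substitutable X (formulas L)"

text \<open>The relations below are only meaningful between formulas of the language. Indices start at 0.\<close>

primrec subsumes :: "('f, 'p, 'v) lang \<Rightarrow> ('f, 'p, 'v) fm \<Rightarrow> ('f, 'p, 'v) fm \<Rightarrow> bool" where
  "subsumes (LBase A) \<phi> \<psi> \<longleftrightarrow> \<phi> = Base Falsum \<or> \<phi> = \<psi>"
| "subsumes (LBin c L1 L2) \<phi> \<psi> \<longleftrightarrow> (case (\<phi>, \<psi>) of
     (Bin _ \<phi>1 \<phi>2, Bin _ \<psi>1 \<psi>2) \<Rightarrow> subsumes L1 \<phi>1 \<psi>1 \<and> subsumes L2 \<phi>2 \<psi>2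
   | _ \<Rightarrow> False)"
| "subsumes (LBigOr k L) \<phi> \<psi> \<longleftrightarrow> (case (\<phi>, \<psi>) of
     (BigOr \<phi>s, BigOr \<psi>s) \<Rightarrow>
       (\<exists>m. inj_on m {..<length \<phi>s} \<and> m ` {..<length \<phi>s} \<subseteq> {..<length \<psi>s} \<and>
            (\<forall>i<length \<phi>s. subsumes L (\<phi>s ! i) (\<psi>s ! m i)))
   | _ \<Rightarrow> False)"
| "subsumes (LBigAnd L) \<phi> \<psi> \<longleftrightarrow> (case (\<phi>, \<psi>) of
     (BigAnd \<phi>s, BigAnd \<psi>s) \<Rightarrow>
       (\<exists>m. m ` {..<length \<psi>s} \<subseteq> {..<length \<phi>s} \<and>
            (\<forall>i<length \<psi>s. subsumes L (\<phi>s ! m i) (\<psi>s ! i)))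
   | _ \<Rightarrow> False)"
| "subsumes (LQuant q X L) \<phi> \<psi> \<longleftrightarrow> (case (\<phi>, \<psi>) of
     (Quant _ _ \<phi>', Quant _ _ \<psi>') \<Rightarrow> (\<exists>\<pi>. \<pi> permutes X \<and> subsumes L \<phi>' (subst \<pi> \<psi>'))
   | _ \<Rightarrow> False)"
| "subsumes (LExistsForall X L) \<phi> \<psi> \<longleftrightarrow> (case (\<phi>, \<psi>) of
     (Quant q _ \<phi>', Quant q' _ \<psi>') \<Rightarrow>
       (\<exists>\<pi>. \<pi> permutes X \<and> subsumes L \<phi>' (subst \<pi> \<psi>')) \<and> (q = Forall \<or> q' = Exists)
   | _ \<Rightarrow> False)"

definition subs_equiv :: "('f, 'p, 'v) lang \<Rightarrow> ('f, 'p, 'v) fm \<Rightarrow> ('f, 'p, 'v) fm \<Rightarrow> bool" where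
  "subs_equiv L \<phi> \<psi> \<longleftrightarrow> subsumes L \<phi> \<psi> \<and> subsumes L \<psi> \<phi>"

text \<open>The parameter \<open>ord\<close> chooses a total order on each base language \<open>A \<union> {\<bottom>}\<close>.\<close>

type_synonym ('f, 'p, 'v) base_order = "('f, 'p, 'v) fo set \<Rightarrow> ('f, 'p, 'v) fm rel"

definition valid_base_order ::
    "('f, 'p) signature \<Rightarrow> 'v set \<Rightarrow> ('f, 'p, 'v) base_order \<Rightarrow> bool" where
  "valid_base_order \<Sigma> V ord \<longleftrightarrow>
     (\<forall>A. base_set \<Sigma> V A \<longrightarrow>
        linear_order_on (formulas (LBase A)) (ord A) \<and>
        (\<forall>\<phi>\<in>formulas (LBase A). \<forall>\<psi>\<in>formulas (LBase A).
           subsumes (LBase A) \<phi> \<psi> \<longrightarrow> (\<phi>, \<psi>) \<in> ord A))"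

definition strict :: "('a \<Rightarrow> 'a \<Rightarrow> bool) \<Rightarrow> 'a \<Rightarrow> 'a \<Rightarrow> bool" where
  "strict le x y \<longleftrightarrow> le x y \<and> x \<noteq> y"

definition lex_less :: "('a \<Rightarrow> 'a \<Rightarrow> bool) \<Rightarrow> 'a list \<Rightarrow> 'a list \<Rightarrow> bool" where
  "lex_less le xs ys \<longleftrightarrow>
     (\<exists>i. i < length xs \<and> i < length ys \<and> strict le (xs ! i) (ys ! i) \<and> (\<forall>j<i. xs ! j = ys ! j))"

primrec lang_le ::
    "('f, 'p, 'v) base_order \<Rightarrow> ('f, 'p, 'v) lang \<Rightarrow> ('f, 'p, 'v) fm \<Rightarrow> ('f, 'p, 'v) fm \<Rightarrow> bool"
where
  "lang_le ord (LBase A) \<phi> \<psi> \<longleftrightarrow> (\<phi>, \<psi>) \<in> ord A"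
| "lang_le ord (LBin c L1 L2) \<phi> \<psi> \<longleftrightarrow> (case (\<phi>, \<psi>) of
     (Bin _ \<phi>1 \<phi>2, Bin _ \<psi>1 \<psi>2) \<Rightarrow>
       strict (lang_le ord L1) \<phi>1 \<psi>1 \<or> \<phi>1 = \<psi>1 \<and> lang_le ord L2 \<phi>2 \<psi>2
   | _ \<Rightarrow> False)"
| "lang_le ord (LBigOr k L) \<phi> \<psi> \<longleftrightarrow> (case (\<phi>, \<psi>) of
     (BigOr \<phi>s, BigOr \<psi>s) \<Rightarrow> suffix \<phi>s \<psi>s \<or> lex_less (lang_le ord L) (rev \<phi>s) (rev \<psi>s)
   | _ \<Rightarrow> False)"
| "lang_le ord (LBigAnd L) \<phi> \<psi> \<longleftrightarrow> (case (\<phi>, \<psi>) of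
     (BigAnd \<phi>s, BigAnd \<psi>s) \<Rightarrow> prefix \<psi>s \<phi>s \<or> lex_less (lang_le ord L) \<phi>s \<psi>s
   | _ \<Rightarrow> False)"
| "lang_le ord (LQuant q X L) \<phi> \<psi> \<longleftrightarrow> (case (\<phi>, \<psi>) of
     (Quant _ _ \<phi>', Quant _ _ \<psi>') \<Rightarrow> lang_le ord L \<phi>' \<psi>'
   | _ \<Rightarrow> False)"
| "lang_le ord (LExistsForall X L) \<phi> \<psi> \<longleftrightarrow> (case (\<phi>, \<psi>) of
     (Quant q _ \<phi>', Quant q' _ \<psi>') \<Rightarrow>
       q = q' \<and> lang_le ord L \<phi>' \<psi>' \<or> q = Forall \<and> q' = Exists
   | _ \<Rightarrow> False)"

definition minimal_elems :: "('a \<Rightarrow> 'a \<Rightarrow> bool) \<Rightarrow> 'a set \<Rightarrow> 'a set" where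
  "minimal_elems R F = {x \<in> F. \<forall>y \<in> F - {x}. \<not> R y x}"

definition least_elem :: "('a \<Rightarrow> 'a \<Rightarrow> bool) \<Rightarrow> 'a set \<Rightarrow> 'a" where
  "least_elem le F = (THE x. x \<in> F \<and> (\<forall>y\<in>F. le x y))"

definition sort_by :: "('a \<Rightarrow> 'a \<Rightarrow> bool) \<Rightarrow> 'a multiset \<Rightarrow> 'a list" where
  "sort_by le M = (THE xs. mset xs = M \<and> sorted_wrt le xs)"

primrec canon ::
    "('f, 'p, 'v) base_order \<Rightarrow> ('f, 'p, 'v) lang \<Rightarrow> ('f, 'p, 'v) fm \<Rightarrow> ('f, 'p, 'v) fm"
where
  "canon ord (LBase A) \<phi> = \<phi>"
| "canon ord (LBin c L1 L2) \<phi> = (case \<phi> of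
     Bin c' \<phi>1 \<phi>2 \<Rightarrow> Bin c' (canon ord L1 \<phi>1) (canon ord L2 \<phi>2)
   | _ \<Rightarrow> \<phi>)"
| "canon ord (LBigOr k L) \<phi> = (case \<phi> of
     BigOr \<phi>s \<Rightarrow> BigOr (sort_by (lang_le ord L) (mset (map (canon ord L) \<phi>s)))
   | _ \<Rightarrow> \<phi>)"
| "canon ord (LBigAnd L) \<phi> = (case \<phi> of
     BigAnd \<phi>s \<Rightarrow>
       BigAnd (sort_by (lang_le ord L)
         (mset_set (minimal_elems (subsumes L) (set (map (canon ord L) \<phi>s)))))
   | _ \<Rightarrow> \<phi>)"
| "canon ord (LQuant q X L) \<phi> = (case \<phi> of
     Quant q' Y \<phi>' \<Rightarrow>
       Quant q' Y (least_elem (lang_le ord L) {canon ord L (subst \<pi> \<phi>') | \<pi>. \<pi> permutes X})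
   | _ \<Rightarrow> \<phi>)"
| "canon ord (LExistsForall X L) \<phi> = (case \<phi> of
     Quant q' Y \<phi>' \<Rightarrow>
       Quant q' Y (least_elem (lang_le ord L) {canon ord L (subst \<pi> \<phi>') | \<pi>. \<pi> permutes X})
   | _ \<Rightarrow> \<phi>)"

definition canonical :: "('f, 'p, 'v) base_order \<Rightarrow> ('f, 'p, 'v) lang \<Rightarrow> ('f, 'p, 'v) fm set" where
  "canonical ord L = {\<phi> \<in> formulas L. canon ord L \<phi> = \<phi>}"

definition canonicalization :: "'a set \<Rightarrow> ('a \<Rightarrow> 'a \<Rightarrow> bool) \<Rightarrow> ('a \<Rightarrow> 'a) \<Rightarrow> bool" where
  "canonicalization S eqv c \<longleftrightarrow>
     (\<forall>x\<in>S. c x \<in> S \<and> eqv (c x) x) \<and> (\<forall>x\<in>S. \<forall>y\<in>S. eqv x y \<longleftrightarrow> c x = c y)"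

text \<open>The restriction of a binary predicate to a carrier, in the form the library orders expect.\<close>

definition rel_on :: "'a set \<Rightarrow> ('a \<Rightarrow> 'a \<Rightarrow> bool) \<Rightarrow> 'a rel" where
  "rel_on S R = {(x, y). x \<in> S \<and> y \<in> S \<and> R x y}"

end

theory Submission
  imports Defs
begin

text \<open>
  Every construction of a language preserves the following package: \<open>\<sqsubseteq>\<close> is a preorder, every formula
  is equivalent to its canonical form, equivalent formulas have the same canonical form, and \<open>\<le>\<close> is a
  total order on canonical formulas that extends \<open>\<sqsubseteq>\<close>. The point is that the third item is a
  consequence of the others: if \<open>\<phi> \<equiv> \<psi>\<close>, then the canonical forms subsume each other, so each is
  \<open>\<le>\<close> the other, and they are equal by antisymmetry. It is enough to exhibit a set that
  contains all canonical forms and on which \<open>\<le>\<close> is a total order extending \<open>\<sqsubseteq>\<close>: sorted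
  sequences for \<open>\<Or>\<close>, sorted antichains for \<open>\<And>\<close>, and bodies that are \<open>\<le>\<close>-least in their orbit
  for quantifiers.
\<close>

section \<open>Totally ordered carriers\<close>

text \<open>The carrier is explicit so that one order predicate can be restricted to subsets and
  lifted to products, lists and images under formula constructors.\<close>

locale ordered_carrier =
  fixes C :: "'a set" and le :: "'a \<Rightarrow> 'a \<Rightarrow> bool"
  assumes le_refl: "x \<in> C \<Longrightarrow> le x x"
    and le_antisym: "\<lbrakk>x \<in> C; y \<in> C; le x y; le y x\<rbrakk> \<Longrightarrow> x = y"
    and le_trans: "\<lbrakk>x \<in> C; y \<in> C; z \<in> C; le x y; le y z\<rbrakk> \<Longrightarrow> le x z"
    and le_total: "\<lbrakk>x \<in> C; y \<in> C\<rbrakk> \<Longrightarrow> le x y \<or> le y x"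

lemma ordered_carrier_mono:
  assumes "ordered_carrier C le" and "B \<subseteq> C"
  shows "ordered_carrier B le"
  using assms unfolding ordered_carrier_def by (meson subsetD)

text \<open>This carries orders on pairs or lists of components over to the formulas built from
  them. Antisymmetry survives because images comparable both ways have preimages comparable both
  ways, which are equal.\<close>

lemma ordered_carrier_image:
  assumes "ordered_carrier C le"
    and "\<And>x y. \<lbrakk>x \<in> C; y \<in> C\<rbrakk> \<Longrightarrow> le' (f x) (f y) \<longleftrightarrow> le x y"
  shows "ordered_carrier (f ` C) le'"
proof -
  interpret ordered_carrier C le by fact
  show ?thesis
  proof
    fix x y assume "x \<in> f ` C" "y \<in> f ` C" "le' x y" "le' y x"
    then show "x = y" using assms(2) le_antisym by (metis imageE)
  next
    fix x y z assume "x \<in> f ` C" "y \<in> f ` C" "z \<in> f ` C" "le' x y" "le' y z"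
    then show "le' x z" using assms(2) le_trans by (smt (verit) imageE)
  next
    fix x y assume "x \<in> f ` C" "y \<in> f ` C"
    then show "le' x y \<or> le' y x" using assms(2) le_total by (metis imageE)
  qed (use assms(2) le_refl in auto)
qed

section \<open>Lexicographic orders on sequences\<close>

lemma lex_less_Nil [simp]: "\<not> lex_less le [] ys" "\<not> lex_less le xs []"
  by (auto simp: lex_less_def)

text \<open>The first difference lies either at index 0 or, shifted by one, inside the tails. This
  recursion replaces index arguments by structural induction on lists.\<close>

lemma lex_less_Cons [simp]:
  "lex_less le (x # xs) (y # ys) \<longleftrightarrow> strict le x y \<or> x = y \<and> lex_less le xs ys"
proof
  assume "lex_less le (x # xs) (y # ys)"
  then obtain i where i: "i < length (x # xs)" "i < length (y # ys)"
      "strict le ((x # xs) ! i) ((y # ys) ! i)" "\<forall>j<i. (x # xs) ! j = (y # ys) ! j"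
    unfolding lex_less_def by blast
  show "strict le x y \<or> x = y \<and> lex_less le xs ys"
  proof (cases i)
    case 0
    then show ?thesis using i by simp
  next
    case (Suc k)
    have "x = y" using i(4) Suc by force
    moreover have "\<forall>j<k. xs ! j = ys ! j" using i(4) Suc by force
    ultimately show ?thesis using i Suc unfolding lex_less_def by auto
  qed
next
  assume "strict le x y \<or> x = y \<and> lex_less le xs ys"
  then show "lex_less le (x # xs) (y # ys)"
  proof
    assume "strict le x y"
    then show ?thesis unfolding lex_less_def by (intro exI[of _ 0]) simp
  next
    assume "x = y \<and> lex_less le xs ys"
    then obtain i where "x = y" "i < length xs" "i < length ys" "strict le (xs ! i) (ys ! i)"
        "\<forall>j<i. xs ! j = ys ! j"
      unfolding lex_less_def by blast
    then show ?thesis unfolding lex_less_def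
      by (intro exI[of _ "Suc i"]) (auto simp: nth_Cons split: nat.split)
  qed
qed

text \<open>The dictionary order in which a proper prefix is smaller; applied to reversed sequences
  it is the order on disjunctions.\<close>

definition prefix_lex :: "('a \<Rightarrow> 'a \<Rightarrow> bool) \<Rightarrow> 'a list \<Rightarrow> 'a list \<Rightarrow> bool" where
  "prefix_lex le xs ys \<longleftrightarrow> prefix xs ys \<or> lex_less le xs ys"

text \<open>Here a proper extension is smaller, because adding conjuncts moves a conjunction down in
  subsumption.\<close>

definition extension_lex :: "('a \<Rightarrow> 'a \<Rightarrow> bool) \<Rightarrow> 'a list \<Rightarrow> 'a list \<Rightarrow> bool" where
  "extension_lex le xs ys \<longleftrightarrow> prefix ys xs \<or> lex_less le xs ys"

lemma prefix_lex_simps [simp]: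
  "prefix_lex le [] ys"
  "\<not> prefix_lex le (x # xs) []"
  "prefix_lex le (x # xs) (y # ys) \<longleftrightarrow> strict le x y \<or> x = y \<and> prefix_lex le xs ys"
  by (auto simp: prefix_lex_def)

lemma extension_lex_simps [simp]:
  "extension_lex le xs []"
  "\<not> extension_lex le [] (y # ys)"
  "extension_lex le (x # xs) (y # ys) \<longleftrightarrow> strict le x y \<or> x = y \<and> extension_lex le xs ys"
  by (auto simp: extension_lex_def)

context ordered_carrier
begin

lemma strict_trans:
  "\<lbrakk>x \<in> C; y \<in> C; z \<in> C; strict le x y; strict le y z\<rbrakk> \<Longrightarrow> strict le x z"
  unfolding strict_def using le_trans le_antisym by blast

lemma strict_asym: "\<lbrakk>x \<in> C; y \<in> C; strict le x y; strict le y x\<rbrakk> \<Longrightarrow> False"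
  unfolding strict_def using le_antisym by blast

lemma strict_cases:
  assumes "x \<in> C" "y \<in> C"
  obtains "strict le x y" | "x = y" | "strict le y x"
  using assms le_total unfolding strict_def by blast

lemma ordered_carrier_prefix_lex: "ordered_carrier (lists C) (prefix_lex le)"
proof
  fix xs assume "xs \<in> lists C"
  show "prefix_lex le xs xs" by (simp add: prefix_lex_def)
next
  fix xs ys
  assume "xs \<in> lists C" "ys \<in> lists C" "prefix_lex le xs ys" "prefix_lex le ys xs"
  then show "xs = ys"
  proof (induction xs arbitrary: ys rule: list.induct)
    case Nil
    then show ?case by (cases ys) auto
  next
    case (Cons x xs)
    then obtain y ys' where ys: "ys = y # ys'" by (cases ys) auto
    then have C: "x \<in> C" "y \<in> C" "xs \<in> lists C" "ys' \<in> lists C" using Cons.prems by auto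
    then have "x = y" using Cons.prems(3,4) ys strict_asym by auto
    moreover from this have "xs = ys'"
      using Cons.prems(3,4) Cons.IH[of ys'] ys C by (simp add: strict_def)
    ultimately show ?case using ys by simp
  qed
next
  fix xs ys zs
  assume "xs \<in> lists C" "ys \<in> lists C" "zs \<in> lists C" "prefix_lex le xs ys" "prefix_lex le ys zs"
  then show "prefix_lex le xs zs"
  proof (induction xs arbitrary: ys zs rule: list.induct)
    case (Cons x xs')
    then obtain y ys' where ys: "ys = y # ys'" by (cases ys) auto
    with Cons.prems obtain z zs' where zs: "zs = z # zs'" by (cases zs) auto
    then have C: "x \<in> C" "y \<in> C" "z \<in> C" "xs' \<in> lists C" "ys' \<in> lists C" "zs' \<in> lists C"
      using Cons.prems ys by auto
    have "strict le x y \<or> x = y \<and> prefix_lex le xs' ys'" "strict le y z \<or> y = z \<and> prefix_lex le ys' zs'"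
      using Cons.prems(4,5) ys zs by simp_all
    then have "strict le x z \<or> x = z \<and> prefix_lex le xs' zs'"
      using strict_trans[of x y z] Cons.IH[OF C(4-6)] C(1-3) by blast
    then show ?case using zs by simp
  qed simp
next
  fix xs ys assume "xs \<in> lists C" "ys \<in> lists C"
  then show "prefix_lex le xs ys \<or> prefix_lex le ys xs"
  proof (induction xs arbitrary: ys rule: list.induct)
    case (Cons x xs)
    show ?case
    proof (cases "ys = []")
      case False
      then obtain y ys' where ys: "ys = y # ys'" by (cases ys) auto
      with Cons.prems have "prefix_lex le xs ys' \<or> prefix_lex le ys' xs" by (intro Cons.IH) auto
      moreover have "strict le x y \<or> x = y \<or> strict le y x"
        using strict_cases[of x y] Cons.prems ys by auto
      ultimately show ?thesis using ys by auto
    qed simp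
  qed simp
qed

lemma ordered_carrier_extension_lex: "ordered_carrier (lists C) (extension_lex le)"
proof
  fix xs assume "xs \<in> lists C"
  show "extension_lex le xs xs" by (simp add: extension_lex_def)
next
  fix xs ys
  assume "xs \<in> lists C" "ys \<in> lists C" "extension_lex le xs ys" "extension_lex le ys xs"
  then show "xs = ys"
  proof (induction xs arbitrary: ys rule: list.induct)
    case Nil
    then show ?case by (cases ys) auto
  next
    case (Cons x xs)
    then obtain y ys' where ys: "ys = y # ys'" by (cases ys) auto
    then have C: "x \<in> C" "y \<in> C" "xs \<in> lists C" "ys' \<in> lists C" using Cons.prems by auto
    then have "x = y" using Cons.prems(3,4) ys strict_asym by auto
    moreover from this have "xs = ys'"
      using Cons.prems(3,4) Cons.IH[of ys'] ys C by (simp add: strict_def)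
    ultimately show ?case using ys by simp
  qed
next
  fix xs ys zs
  assume "xs \<in> lists C" "ys \<in> lists C" "zs \<in> lists C" "extension_lex le xs ys" "extension_lex le ys zs"
  then show "extension_lex le xs zs"
  \<comment> \<open>Induction runs over \<open>zs\<close>: under \<open>extension_lex\<close> a
    nonempty right-hand list forces a nonempty left-hand list, so the other two lists split along
    with it.\<close>
  proof (induction zs arbitrary: xs ys rule: list.induct)
    case (Cons z zs')
    then obtain y ys' where ys: "ys = y # ys'" by (cases ys) auto
    with Cons.prems obtain x xs' where xs: "xs = x # xs'" by (cases xs) auto
    then have C: "x \<in> C" "y \<in> C" "z \<in> C" "xs' \<in> lists C" "ys' \<in> lists C" "zs' \<in> lists C"
      using Cons.prems ys by auto
    have "strict le x y \<or> x = y \<and> extension_lex le xs' ys'" "strict le y z \<or> y = z \<and> extension_lex le ys' zs'"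
      using Cons.prems(4,5) ys xs by simp_all
    then have "strict le x z \<or> x = z \<and> extension_lex le xs' zs'"
      using strict_trans[of x y z] Cons.IH[OF C(4-6)] C(1-3) by blast
    then show ?case using xs by simp
  qed simp
next
  fix xs ys assume "xs \<in> lists C" "ys \<in> lists C"
  then show "extension_lex le xs ys \<or> extension_lex le ys xs"
  proof (induction xs arbitrary: ys rule: list.induct)
    case (Cons x xs)
    show ?case
    proof (cases "ys = []")
      case False
      then obtain y ys' where ys: "ys = y # ys'" by (cases ys) auto
      with Cons.prems have "extension_lex le xs ys' \<or> extension_lex le ys' xs" by (intro Cons.IH) auto
      moreover have "strict le x y \<or> x = y \<or> strict le y x"
        using strict_cases[of x y] Cons.prems ys by auto
      ultimately show ?thesis using ys by auto
    qed simp
  qed simp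
qed

section \<open>Sorting and least elements\<close>

lemma ex_sorted_list:
  "set_mset M \<subseteq> C \<Longrightarrow> \<exists>xs. mset xs = M \<and> sorted_wrt le xs"
proof (induction M)
  case (add x M)
  then obtain xs where xs: "mset xs = M" "sorted_wrt le xs" by auto
  have C: "x \<in> C" "set xs \<subseteq> C" using add.prems xs(1) by auto
  \<comment> \<open>Partitioning around \<open>x\<close> keeps both halves sorted, and totality puts
    every rejected entry above \<open>x\<close>.\<close>
  let ?ys = "filter (\<lambda>y. le y x) xs @ x # filter (\<lambda>y. \<not> le y x) xs"
  have above: "le x z" if "z \<in> set xs" "\<not> le z x" for z
    using that C le_total by blast
  then have trans: "le y z" if "y \<in> set xs" "le y x" "z \<in> set xs" "\<not> le z x" for y z
    using that C le_trans[of y x z] by blast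
  have "mset ?ys = add_mset x M"
    by (simp add: xs(1)[symmetric])
  moreover have "sorted_wrt le ?ys"
    using xs(2) above trans by (auto simp: sorted_wrt_append intro: sorted_wrt_filter)
  ultimately show ?case by blast
qed simp

text \<open>Two different heads would each occur in the tail of the other list and hence lie below
  each other, against antisymmetry.\<close>

lemma sorted_list_unique:
  "\<lbrakk>set xs \<subseteq> C; mset xs = mset ys; sorted_wrt le xs; sorted_wrt le ys\<rbrakk> \<Longrightarrow> xs = ys"
proof (induction xs arbitrary: ys rule: list.induct)
  case (Cons x xs)
  then obtain y ys' where ys: "ys = y # ys'" by (cases ys) auto
  have set: "set (x # xs) = set ys" using Cons.prems(2) mset_eq_setD by blast
  have "x = y"
  proof (rule ccontr)
    assume "x \<noteq> y"
    with set ys have "x \<in> set ys'" "y \<in> set xs" by auto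
    with Cons.prems ys have "le x y" "le y x" "x \<in> C" "y \<in> C" by auto
    with \<open>x \<noteq> y\<close> show False using le_antisym by blast
  qed
  with Cons ys show ?case by auto
qed simp

text \<open>Existence and uniqueness of the sorted list make the definite description in
  \<open>sort_by\<close> denote it.\<close>

lemma sort_by:
  assumes "set_mset M \<subseteq> C"
  shows "mset (sort_by le M) = M" and "sorted_wrt le (sort_by le M)"
proof -
  have "\<exists>!xs. mset xs = M \<and> sorted_wrt le xs"
    using ex_sorted_list[OF assms] sorted_list_unique assms by (metis set_mset_mset)
  from theI'[OF this] show "mset (sort_by le M) = M" "sorted_wrt le (sort_by le M)"
    unfolding sort_by_def by blast+
qed

lemma ex_least:
  "\<lbrakk>finite A; A \<noteq> {}; A \<subseteq> C\<rbrakk> \<Longrightarrow> \<exists>x\<in>A. \<forall>y\<in>A. le x y"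
proof (induction rule: finite_ne_induct)
  case (singleton x)
  then show ?case using le_refl by auto
next
  case (insert x A)
  then obtain m where m: "m \<in> A" "\<forall>y\<in>A. le m y" by auto
  show ?case
  proof (cases "le m x")
    case True
    with m show ?thesis by auto
  next
    case False
    with insert.prems m have "le x m" using le_total by blast
    with insert.prems m have "\<forall>y\<in>A. le x y" using le_trans by blast
    with insert.prems show ?thesis using le_refl by auto
  qed
qed

lemma least_elem:
  assumes "finite A" "A \<noteq> {}" "A \<subseteq> C"
  shows "least_elem le A \<in> A" and "y \<in> A \<Longrightarrow> le (least_elem le A) y"
proof -
  have "\<exists>!x. x \<in> A \<and> (\<forall>y\<in>A. le x y)"
    using ex_least[OF assms] le_antisym assms(3) by blast
  from theI'[OF this] show "least_elem le A \<in> A" "y \<in> A \<Longrightarrow> le (least_elem le A) y"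
    unfolding least_elem_def by blast+
qed

section \<open>Entrywise comparison of sorted sequences\<close>

lemma sorted_wrt_nth_le:
  assumes "sorted_wrt le xs" "set xs \<subseteq> C" "i \<le> j" "j < length xs"
  shows "le (xs ! i) (xs ! j)"
proof (cases "i = j")
  case True
  then show ?thesis using assms le_refl by (simp add: subset_iff)
next
  case False
  then show ?thesis using assms by (simp add: sorted_wrt_nth_less)
qed

text \<open>Where the lists first differ, the entrywise comparison is strict; if they never differ,
  \<open>xs\<close> is a prefix of \<open>ys\<close>.\<close>

lemma pointwise_le_imp_prefix_lex:
  assumes "xs \<in> lists C" "ys \<in> lists C" "length xs \<le> length ys"
    and "\<And>i. i < length xs \<Longrightarrow> le (xs ! i) (ys ! i)"
  shows "prefix_lex le xs ys"
  using assms
proof (induction xs arbitrary: ys rule: list.induct)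
  case (Cons x xs)
  then obtain y ys' where ys: "ys = y # ys'" by (cases ys) auto
  have "le x y" using Cons.prems(4)[of 0] ys by simp
  moreover have "prefix_lex le xs ys'"
  proof (rule Cons.IH)
    fix i assume "i < length xs"
    then show "le (xs ! i) (ys' ! i)" using Cons.prems(4)[of "Suc i"] ys by simp
  qed (use Cons.prems(1-3) ys in auto)
  ultimately show ?case using ys by (auto simp: strict_def)
qed simp

text \<open>
  The \<open>k\<close>-th largest entry of \<open>xs\<close> is below the \<open>k\<close>-th largest entry of \<open>ys\<close>: of the \<open>k + 1\<close>
  largest entries of \<open>xs\<close>, one is matched with an entry of \<open>ys\<close> outside the \<open>k\<close> largest.
\<close>

lemma matching_imp_prefix_lex_rev:
  assumes xs: "set xs \<subseteq> C" "sorted_wrt le xs" and ys: "set ys \<subseteq> C" "sorted_wrt le ys"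
    and m: "inj_on m {..<length xs}" "m ` {..<length xs} \<subseteq> {..<length ys}"
      "\<And>i. i < length xs \<Longrightarrow> le (xs ! i) (ys ! m i)"
  shows "prefix_lex le (rev xs) (rev ys)"
proof -
  have len: "length xs \<le> length ys"
    using card_inj_on_le[OF m(1,2)] by simp
  have "le (xs ! (length xs - Suc k)) (ys ! (length ys - Suc k))" if k: "k < length xs" for k
  proof -
    let ?I = "{length xs - Suc k..<length xs}"
    have "\<exists>i\<in>?I. m i \<le> length ys - Suc k"
    proof (rule ccontr)
      assume "\<not> ?thesis"
      then have "\<forall>i\<in>?I. length ys - k \<le> m i" using len k by auto
      moreover have "\<forall>i\<in>?I. m i < length ys" using m(2) by (simp add: image_subset_iff)
      ultimately have "m ` ?I \<subseteq> {length ys - k..<length ys}" by auto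
      moreover have "inj_on m ?I" by (rule inj_on_subset[OF m(1)]) auto
      ultimately have "card ?I \<le> card {length ys - k..<length ys}"
        by (intro card_inj_on_le) auto
      with k len show False by simp
    qed
    then obtain i where i: "length xs - Suc k \<le> i" "i < length xs" "m i \<le> length ys - Suc k"
      by auto
    have "le (xs ! (length xs - Suc k)) (xs ! i)"
      using i xs by (intro sorted_wrt_nth_le)
    moreover have "le (xs ! i) (ys ! m i)" using i m(3) by blast
    moreover have "le (ys ! m i) (ys ! (length ys - Suc k))"
      using i ys len k by (intro sorted_wrt_nth_le) auto
    moreover have "xs ! (length xs - Suc k) \<in> C" "xs ! i \<in> C" "ys ! m i \<in> C"
        "ys ! (length ys - Suc k) \<in> C"
      using xs(1) ys(1) i k len m(2) by (auto simp: subset_iff)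
    ultimately show ?thesis using le_trans by metis
  qed
  note le = this
  show ?thesis
  proof (rule pointwise_le_imp_prefix_lex)
    fix k assume "k < length (rev xs)"
    then show "le (rev xs ! k) (rev ys ! k)" using le[of k] len by (simp add: rev_nth)
  qed (use xs(1) ys(1) len in \<open>auto simp: subset_iff\<close>)
qed

end

section \<open>Canonicalization systems\<close>

text \<open>\<open>sub\<close> is a preorder on all of \<open>F\<close>, while \<open>le\<close> is
  constrained on the fixed points of \<open>c\<close> only: reordering a disjunction gives an
  equivalent formula, so an antisymmetric order cannot extend \<open>sub\<close> to all
  formulas.\<close>

locale canon_system = ordered_carrier "{x \<in> F. c x = x}" le
  for F :: "'a set" and sub :: "'a \<Rightarrow> 'a \<Rightarrow> bool" and le :: "'a \<Rightarrow> 'a \<Rightarrow> bool" and c :: "'a \<Rightarrow> 'a" +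
  assumes sub_refl: "x \<in> F \<Longrightarrow> sub x x"
    and sub_trans: "\<lbrakk>x \<in> F; y \<in> F; z \<in> F; sub x y; sub y z\<rbrakk> \<Longrightarrow> sub x z"
    and c_closed: "x \<in> F \<Longrightarrow> c x \<in> F"
    and c_sub: "x \<in> F \<Longrightarrow> sub (c x) x"
    and sub_c: "x \<in> F \<Longrightarrow> sub x (c x)"
    and c_cong: "\<lbrakk>x \<in> F; y \<in> F; sub x y; sub y x\<rbrakk> \<Longrightarrow> c x = c y"
    and sub_imp_le: "\<lbrakk>x \<in> F; c x = x; y \<in> F; c y = y; sub x y\<rbrakk> \<Longrightarrow> le x y"
begin

abbreviation C where "C \<equiv> {x \<in> F. c x = x}"

text \<open>Since \<open>c x\<close> is equivalent to \<open>x\<close>, congruence gives idempotence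
  of \<open>c\<close>.\<close>

lemma c_in_C: "x \<in> F \<Longrightarrow> c x \<in> C"
  using c_closed[of x] c_cong[of "c x" x] c_sub[of x] sub_c[of x] by blast

lemma sub_antisym: "\<lbrakk>x \<in> C; y \<in> C; sub x y; sub y x\<rbrakk> \<Longrightarrow> x = y"
  using c_cong[of x y] by simp

end

text \<open>A fixed point \<open>x\<close> equals \<open>c x\<close> and so lies in
  \<open>S\<close>. Hence \<open>S\<close> may be any convenient superset of the canonical formulas,
  and these need not be characterized exactly.\<close>

lemma canon_systemI:
  assumes refl: "\<And>x. x \<in> F \<Longrightarrow> sub x x"
    and trans: "\<And>x y z. \<lbrakk>x \<in> F; y \<in> F; z \<in> F; sub x y; sub y z\<rbrakk> \<Longrightarrow> sub x z"
    and S: "S \<subseteq> F" "\<And>x. x \<in> F \<Longrightarrow> c x \<in> S"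
    and equiv: "\<And>x. x \<in> F \<Longrightarrow> sub (c x) x" "\<And>x. x \<in> F \<Longrightarrow> sub x (c x)"
    and ord: "ordered_carrier S le"
    and ext: "\<And>x y. \<lbrakk>x \<in> S; y \<in> S; sub x y\<rbrakk> \<Longrightarrow> le x y"
  shows "canon_system F sub le c"
proof -
  interpret S: ordered_carrier S le by fact
  have CS: "{x \<in> F. c x = x} \<subseteq> S"
  proof
    fix x assume "x \<in> {x \<in> F. c x = x}"
    then show "x \<in> S" using S(2)[of x] by simp
  qed
  \<comment> \<open>The chain is \<open>c x\<close>, \<open>x\<close>, \<open>y\<close>,
    \<open>c y\<close>, each subsuming the next.\<close>
  have c_mono: "sub (c x) (c y)" if "x \<in> F" "y \<in> F" "sub x y" for x y
  proof -
    have "c x \<in> F" "c y \<in> F" using that(1,2) S by auto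
    then show ?thesis
      using that trans[of "c x" x y] trans[of "c x" y "c y"] equiv(1)[of x] equiv(2)[of y] by blast
  qed
  have "c x = c y" if "x \<in> F" "y \<in> F" "sub x y" "sub y x" for x y
  proof (rule S.le_antisym)
    show "c x \<in> S" "c y \<in> S" using that S(2) by auto
    then show "le (c x) (c y)" "le (c y) (c x)" using that c_mono ext by auto
  qed
  note cong = this
  interpret C: ordered_carrier "{x \<in> F. c x = x}" le by (rule ordered_carrier_mono[OF ord CS])
  show ?thesis
  proof
    fix x assume "x \<in> F"
    then show "sub x x" "c x \<in> F" "sub (c x) x" "sub x (c x)" using refl S equiv by auto
  next
    fix x y z assume "x \<in> F" "y \<in> F" "z \<in> F" "sub x y" "sub y z"
    then show "sub x z" by (rule trans)
  next
    fix x y assume "x \<in> F" "y \<in> F" "sub x y" "sub y x"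
    then show "c x = c y" by (rule cong)
  next
    fix x y assume "x \<in> F" "c x = x" "y \<in> F" "c y = y" "sub x y"
    then show "le x y" using ext CS by blast
  qed
qed

section \<open>Substitution\<close>

lemma subst_cong:
  "(\<And>x. x \<in> fv \<phi> \<Longrightarrow> \<sigma> x = \<tau> x) \<Longrightarrow> subst \<sigma> \<phi> = subst \<tau> \<phi>"
proof (induction \<phi> arbitrary: \<sigma> \<tau>)
  case (Base a)
  then show ?case by (auto intro: fo.map_cong0)
next
  case (Bin c \<phi> \<psi>)
  then show ?case by (metis UnCI fv.simps(2) subst.simps(2))
next
  case (BigOr \<phi>s)
  have "subst \<sigma> \<phi> = subst \<tau> \<phi>" if "\<phi> \<in> set \<phi>s" for \<phi>
    by (rule BigOr.IH[OF that]) (use BigOr.prems that in auto)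
  then show ?case by simp
next
  case (BigAnd \<phi>s)
  have "subst \<sigma> \<phi> = subst \<tau> \<phi>" if "\<phi> \<in> set \<phi>s" for \<phi>
    by (rule BigAnd.IH[OF that]) (use BigAnd.prems that in auto)
  then show ?case by simp
next
  case (Quant q Y \<phi>)
  \<comment> \<open>Overriding makes both substitutions the identity on \<open>Y\<close>, so
    agreement on the free variables outside \<open>Y\<close> is enough.\<close>
  have "subst (override_on \<sigma> id Y) \<phi> = subst (override_on \<tau> id Y) \<phi>"
    by (rule Quant.IH) (use Quant.prems in \<open>auto simp: override_on_def\<close>)
  then show ?case by simp
qed

lemma subst_id: "subst id \<phi> = \<phi>"
proof (induction \<phi>)
  case (Base a)
  show ?case by (simp only: subst.simps fo.map_id)
next
  case (Quant q Y \<phi>)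
  have "override_on id id Y = (id :: 'c \<Rightarrow> 'c)" by (auto simp: override_on_def)
  then show ?case using Quant by (simp only: subst.simps)
qed (auto simp: map_idI)

lemma subst_ident: "(\<And>x. x \<in> fv \<phi> \<Longrightarrow> \<sigma> x = x) \<Longrightarrow> subst \<sigma> \<phi> = \<phi>"
  using subst_cong[of \<phi> \<sigma> id] by (simp add: subst_id)

lemma subst_subst: "capture_free \<sigma> \<phi> \<Longrightarrow> subst \<pi> (subst \<sigma> \<phi>) = subst (\<pi> \<circ> \<sigma>) \<phi>"
proof (induction \<phi> arbitrary: \<sigma> \<pi>)
  case (Base a)
  show ?case by (simp only: subst.simps fo.map_comp)
next
  case (Quant q Y \<phi>)
  have "subst (override_on \<pi> id Y) (subst (override_on \<sigma> id Y) \<phi>)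
      = subst (override_on \<pi> id Y \<circ> override_on \<sigma> id Y) \<phi>"
    by (rule Quant.IH) (use Quant.prems in auto)
  \<comment> \<open>By capture freeness a free variable outside \<open>Y\<close> is not sent into
    \<open>Y\<close>, so the override on \<open>Y\<close> does not stop \<open>\<pi>\<close> from
    acting on its image.\<close>
  also have "\<dots> = subst (override_on (\<pi> \<circ> \<sigma>) id Y) \<phi>"
    by (rule subst_cong) (use Quant.prems in \<open>auto simp: override_on_def\<close>)
  finally show ?case by (simp only: subst.simps)
qed auto

section \<open>Substitutability inherited by component languages\<close>

text \<open>To infer capture freeness of one component from a binary formula, some formula must fill
  the other component.\<close>

lemma formulas_nonempty: "formulas L \<noteq> {}"
proof (induction L)
  case (LBigOr k L)
  have "BigOr [] \<in> formulas (LBigOr k L)" by simp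
  then show ?case by blast
next
  case (LBigAnd L)
  then obtain \<phi> where "\<phi> \<in> formulas L" by blast
  then have "BigAnd [\<phi>] \<in> formulas (LBigAnd L)" by simp
  then show ?case by blast
qed auto

lemma substitutable_Bin:
  assumes "substitutable X (formulas (LBin c L1 L2))"
  shows "substitutable X (formulas L1)" "substitutable X (formulas L2)"
  using assms formulas_nonempty[of L1] formulas_nonempty[of L2]
  unfolding substitutable_def by fastforce+

text \<open>A one-element disjunction embeds each formula of \<open>L\<close>. For
  \<open>k = 0\<close> only the empty disjunction exists, which says nothing about
  \<open>L\<close>.\<close>

lemma substitutable_BigOr:
  assumes "substitutable X (formulas (LBigOr k L))" and "k \<noteq> 0"
  shows "substitutable X (formulas L)"
  unfolding substitutable_def
proof (intro allI impI, elim conjE)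
  fix \<pi> \<phi> assume "\<pi> permutes X" "\<phi> \<in> formulas L"
  moreover from this have "BigOr [\<phi>] \<in> formulas (LBigOr k L)" using assms(2) by simp
  ultimately have "capture_free \<pi> (BigOr [\<phi>])" using assms(1) unfolding substitutable_def by blast
  then show "capture_free \<pi> \<phi>" by simp
qed

lemma substitutable_BigAnd:
  assumes "substitutable X (formulas (LBigAnd L))"
  shows "substitutable X (formulas L)"
  unfolding substitutable_def
proof (intro allI impI, elim conjE)
  fix \<pi> \<phi> assume "\<pi> permutes X" "\<phi> \<in> formulas L"
  moreover from this have "BigAnd [\<phi>] \<in> formulas (LBigAnd L)" by simp
  ultimately have "capture_free \<pi> (BigAnd [\<phi>])" using assms unfolding substitutable_def by blast
  then show "capture_free \<pi> \<phi>" by simp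
qed

lemma override_on_permutes: "\<lbrakk>\<pi> permutes X; X \<inter> Y = {}\<rbrakk> \<Longrightarrow> override_on \<pi> id Y = \<pi>"
  by (auto simp: override_on_def fun_eq_iff permutes_def)

text \<open>
  If \<open>X\<close> meets the inner block \<open>Y\<close>, swapping an element of \<open>X \<inter> Y\<close> with a free variable in \<open>X\<close>
  would cause a capture, so permutations of \<open>X\<close> act trivially on the whole quantified formula.
\<close>

lemma substitutable_Quant:
  assumes "substitutable X {Quant q Y \<phi> | \<phi>. \<phi> \<in> F}"
  shows "X \<inter> Y = {} \<and> substitutable X F
    \<or> (\<forall>\<pi> \<phi>. \<pi> permutes X \<and> \<phi> \<in> F \<longrightarrow> subst (override_on \<pi> id Y) \<phi> = \<phi>)"
proof (cases "X \<inter> Y = {}")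
  case True
  have "capture_free \<pi> \<phi>" if "\<pi> permutes X" "\<phi> \<in> F" for \<pi> \<phi>
  proof -
    have "capture_free \<pi> (Quant q Y \<phi>)" using assms that unfolding substitutable_def by blast
    then show ?thesis using override_on_permutes[OF that(1) True] by simp
  qed
  then show ?thesis using True unfolding substitutable_def by blast
next
  case False
  then obtain y where y: "y \<in> X" "y \<in> Y" by blast
  have outside: "x \<notin> X" if "\<phi> \<in> F" "x \<in> fv \<phi> - Y" for x \<phi>
  proof
    assume "x \<in> X"
    then have "Transposition.transpose x y permutes X"
      using y permutes_swap_id by metis
    then have "capture_free (Transposition.transpose x y) (Quant q Y \<phi>)"
      using assms that unfolding substitutable_def by blast
    then have "\<forall>z\<in>fv \<phi> - Y. Transposition.transpose x y z \<notin> Y" by simp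
    then have "Transposition.transpose x y x \<notin> Y" using that(2) by blast
    then show False using y by simp
  qed
  have "subst (override_on \<pi> id Y) \<phi> = \<phi>" if "\<pi> permutes X" "\<phi> \<in> F" for \<pi> \<phi>
    by (rule subst_ident) (use that outside in \<open>force simp: override_on_def permutes_def\<close>)
  then show ?thesis by blast
qed

lemma substitutable_LQuant:
  "substitutable X (formulas (LQuant q Y L)) \<Longrightarrow> X \<inter> Y = {} \<and> substitutable X (formulas L)
    \<or> (\<forall>\<pi> \<phi>. \<pi> permutes X \<and> \<phi> \<in> formulas L \<longrightarrow> subst (override_on \<pi> id Y) \<phi> = \<phi>)"
  by (simp add: substitutable_Quant)

text \<open>The existential formulas of the language already range over all bodies, and the
  conclusion speaks of bodies only.\<close>

lemma substitutable_LExistsForall: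
  "substitutable X (formulas (LExistsForall Y L)) \<Longrightarrow> X \<inter> Y = {} \<and> substitutable X (formulas L)
    \<or> (\<forall>\<pi> \<phi>. \<pi> permutes X \<and> \<phi> \<in> formulas L \<longrightarrow> subst (override_on \<pi> id Y) \<phi> = \<phi>)"
  by (rule substitutable_Quant[of X Exists]) (auto simp: substitutable_def)

section \<open>Invariance of formulas and subsumption under block permutations\<close>

text \<open>Base sets are closed under permutations of finite subsets of \<open>V\<close>, and
  connectives pass the substitution to their components. An inner block is either disjoint from
  \<open>X\<close>, so that the override changes nothing, or \<open>\<pi>\<close> fixes the
  quantified formula.\<close>

lemma subst_closed:
  assumes "bounded_lang \<Sigma> V L" "finite X" "X \<subseteq> V" "substitutable X (formulas L)"
    and "\<pi> permutes X" "\<phi> \<in> formulas L"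
  shows "subst \<pi> \<phi> \<in> formulas L"
  using assms
proof (induction L arbitrary: \<phi>)
  case (LBase A)
  then have "perm_closed V A" by (simp add: base_set_def)
  with LBase show ?case unfolding perm_closed_def by auto
next
  case (LBin c L1 L2)
  with substitutable_Bin[OF LBin.prems(4)] show ?case by auto
next
  case (LBigOr k L)
  then obtain \<phi>s where \<phi>s: "\<phi> = BigOr \<phi>s" "\<phi>s \<in> lists (formulas L)" "length \<phi>s \<le> k" by auto
  show ?case
  proof (cases "k = 0")
    case False
    then show ?thesis using \<phi>s substitutable_BigOr[OF LBigOr.prems(4)] LBigOr by auto
  qed (use \<phi>s in auto)
next
  case (LBigAnd L)
  with substitutable_BigAnd[OF LBigAnd.prems(4)] show ?case by auto
next
  case (LQuant q Y L)
  then show ?case using substitutable_LQuant[OF LQuant.prems(4)]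
    by (auto simp: override_on_permutes)
next
  case (LExistsForall Y L)
  then show ?case using substitutable_LExistsForall[OF LExistsForall.prems(4)]
    by (auto simp: override_on_permutes)
qed

text \<open>Permutations of disjoint sets commute: each preserves its own block and is the identity
  on the other. Capture freeness turns this into a statement about substitutions.\<close>

lemma subst_disjoint_blocks_commute:
  assumes X: "substitutable X F" "\<pi> permutes X" and Y: "substitutable Y F" "\<sigma> permutes Y"
    and disj: "X \<inter> Y = {}" and \<psi>: "\<psi> \<in> F"
  shows "subst \<pi> (subst \<sigma> \<psi>) = subst \<sigma> (subst \<pi> \<psi>)"
proof -
  have "\<pi> \<circ> \<sigma> = \<sigma> \<circ> \<pi>"
  proof
    fix x
    have "\<sigma> x \<in> Y \<longleftrightarrow> x \<in> Y" "\<pi> x \<in> X \<longleftrightarrow> x \<in> X"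
      using X(2) Y(2) by (auto simp: permutes_in_image)
    then show "(\<pi> \<circ> \<sigma>) x = (\<sigma> \<circ> \<pi>) x"
      using disj permutes_not_in[OF X(2)] permutes_not_in[OF Y(2)]
      by (metis comp_apply disjoint_iff)
  qed
  then show ?thesis using assms by (simp add: subst_subst substitutable_def)
qed

text \<open>The witness of subsumption survives: index maps stay the same, and the permutation of an
  inner block commutes with \<open>\<pi>\<close> when the blocks are disjoint. When they meet,
  \<open>\<pi>\<close> fixes the quantified formulas.\<close>

lemma subsumes_subst:
  assumes "bounded_lang \<Sigma> V L" "finite X" "X \<subseteq> V" "substitutable X (formulas L)"
    and "\<pi> permutes X" "\<phi> \<in> formulas L" "\<psi> \<in> formulas L" "subsumes L \<phi> \<psi>"
  shows "subsumes L (subst \<pi> \<phi>) (subst \<pi> \<psi>)"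
  using assms
proof (induction L arbitrary: \<phi> \<psi>)
  case (LBase A)
  then show ?case by auto
next
  case (LBin c L1 L2)
  with substitutable_Bin[OF LBin.prems(4)] show ?case by auto
next
  case (LBigOr k L)
  then obtain \<phi>s \<psi>s where *: "\<phi> = BigOr \<phi>s" "\<phi>s \<in> lists (formulas L)" "length \<phi>s \<le> k"
    "\<psi> = BigOr \<psi>s" "\<psi>s \<in> lists (formulas L)" "length \<psi>s \<le> k" by auto
  with LBigOr.prems(8) obtain m where m: "inj_on m {..<length \<phi>s}"
      "m ` {..<length \<phi>s} \<subseteq> {..<length \<psi>s}" "\<forall>i<length \<phi>s. subsumes L (\<phi>s ! i) (\<psi>s ! m i)"
    by auto
  have "subsumes L (subst \<pi> (\<phi>s ! i)) (subst \<pi> (\<psi>s ! m i))" if i: "i < length \<phi>s" for i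
  proof -
    have "k \<noteq> 0" using * i by auto
    moreover have "\<phi>s ! i \<in> formulas L" "\<psi>s ! m i \<in> formulas L"
      using * i m(2) by (auto simp: in_lists_conv_set)
    ultimately show ?thesis
      using LBigOr substitutable_BigOr[OF LBigOr.prems(4)] i m(3) by simp
  qed
  then have "\<forall>i<length \<phi>s. subsumes L (map (subst \<pi>) \<phi>s ! i) (map (subst \<pi>) \<psi>s ! m i)"
    using m(2) by (auto simp: image_subset_iff)
  then show ?case using m * by auto
next
  case (LBigAnd L)
  then obtain \<phi>s \<psi>s where *: "\<phi> = BigAnd \<phi>s" "\<phi>s \<in> lists (formulas L)"
    "\<psi> = BigAnd \<psi>s" "\<psi>s \<in> lists (formulas L)" by auto
  with LBigAnd.prems(8) obtain m where m:
      "m ` {..<length \<psi>s} \<subseteq> {..<length \<phi>s}" "\<forall>i<length \<psi>s. subsumes L (\<phi>s ! m i) (\<psi>s ! i)"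
    by auto
  have "subsumes L (subst \<pi> (\<phi>s ! m i)) (subst \<pi> (\<psi>s ! i))" if i: "i < length \<psi>s" for i
  proof -
    have "\<phi>s ! m i \<in> formulas L" "\<psi>s ! i \<in> formulas L"
      using * i m(1) by (auto simp: in_lists_conv_set)
    then show ?thesis using LBigAnd substitutable_BigAnd[OF LBigAnd.prems(4)] i m(2) by simp
  qed
  then have "\<forall>i<length \<psi>s. subsumes L (map (subst \<pi>) \<phi>s ! m i) (map (subst \<pi>) \<psi>s ! i)"
    using m(1) by (auto simp: image_subset_iff)
  then show ?case using m * by auto
next
  case (LQuant q Y L)
  then obtain \<phi>' \<psi>' \<sigma> where *: "\<phi> = Quant q Y \<phi>'" "\<phi>' \<in> formulas L"
    "\<psi> = Quant q Y \<psi>'" "\<psi>' \<in> formulas L" "\<sigma> permutes Y" "subsumes L \<phi>' (subst \<sigma> \<psi>')" by auto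
  have Y: "bounded_lang \<Sigma> V L" "finite Y" "Y \<subseteq> V" "substitutable Y (formulas L)"
    using LQuant.prems(1) by auto
  from substitutable_LQuant[OF LQuant.prems(4)] show ?case
  proof
    assume X: "X \<inter> Y = {} \<and> substitutable X (formulas L)"
    have "subsumes L (subst \<pi> \<phi>') (subst \<pi> (subst \<sigma> \<psi>'))"
      using LQuant.IH LQuant.prems X Y * subst_closed[OF Y *(5,4)] by blast
    \<comment> \<open>Commuting brings the inner permutation outermost, the form that subsumption of
      the inner block demands.\<close>
    then have "subsumes L (subst \<pi> \<phi>') (subst \<sigma> (subst \<pi> \<psi>'))"
      using subst_disjoint_blocks_commute X Y * LQuant.prems(5) by metis
    then show ?thesis using * X LQuant.prems(5) by (auto simp: override_on_permutes)
  qed (use * LQuant.prems in auto)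
next
  case (LExistsForall Y L)
  then obtain q q' \<phi>' \<psi>' \<sigma> where *: "\<phi> = Quant q Y \<phi>'" "\<phi>' \<in> formulas L"
    "\<psi> = Quant q' Y \<psi>'" "\<psi>' \<in> formulas L" "\<sigma> permutes Y" "subsumes L \<phi>' (subst \<sigma> \<psi>')"
    "q = Forall \<or> q' = Exists" by auto
  have Y: "bounded_lang \<Sigma> V L" "finite Y" "Y \<subseteq> V" "substitutable Y (formulas L)"
    using LExistsForall.prems(1) by auto
  from substitutable_LExistsForall[OF LExistsForall.prems(4)] show ?case
  proof
    assume X: "X \<inter> Y = {} \<and> substitutable X (formulas L)"
    have "subsumes L (subst \<pi> \<phi>') (subst \<pi> (subst \<sigma> \<psi>'))"
      using LExistsForall.IH LExistsForall.prems X Y * subst_closed[OF Y *(5,4)] by blast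
    then have "subsumes L (subst \<pi> \<phi>') (subst \<sigma> (subst \<pi> \<psi>'))"
      using subst_disjoint_blocks_commute X Y * LExistsForall.prems(5) by metis
    then show ?thesis using * X LExistsForall.prems(5) by (auto simp: override_on_permutes)
  qed (use * LExistsForall.prems in auto)
qed

section \<open>Languages\<close>

abbreviation canon_lang :: "('f, 'p, 'v) base_order \<Rightarrow> ('f, 'p, 'v) lang \<Rightarrow> bool" where
  "canon_lang ord L \<equiv> canon_system (formulas L) (subsumes L) (lang_le ord L) (canon ord L)"

section \<open>Base languages and binary connectives\<close>

text \<open>Canonicalization is the identity here, so the whole base language serves as carrier and
  the chosen base order supplies the order properties.\<close>

lemma canon_lang_LBase:
  assumes "base_set \<Sigma> V A" and "valid_base_order \<Sigma> V ord"
  shows "canon_lang ord (LBase A)"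
proof -
  have lin: "linear_order_on (formulas (LBase A)) (ord A)"
    and ext: "\<And>\<phi> \<psi>. \<lbrakk>\<phi> \<in> formulas (LBase A); \<psi> \<in> formulas (LBase A); subsumes (LBase A) \<phi> \<psi>\<rbrakk>
      \<Longrightarrow> (\<phi>, \<psi>) \<in> ord A"
    using assms unfolding valid_base_order_def by blast+
  have ord: "ordered_carrier (formulas (LBase A)) (lang_le ord (LBase A))"
  proof
    fix x y assume "x \<in> formulas (LBase A)" "y \<in> formulas (LBase A)"
    with lin show "lang_le ord (LBase A) x y \<or> lang_le ord (LBase A) y x"
      unfolding order_on_defs total_on_def lang_le.simps by (metis refl_onD)
  next
    fix x y z assume "lang_le ord (LBase A) x y" "lang_le ord (LBase A) y z"
    with lin show "lang_le ord (LBase A) x z"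
      unfolding order_on_defs lang_le.simps by (meson transD)
  qed (use lin in \<open>auto simp: order_on_defs dest: refl_onD antisymD simp del: formulas.simps\<close>)
  show ?thesis
    by (rule canon_systemI[where S = "formulas (LBase A)"])
      (use ord ext in \<open>auto simp del: formulas.simps\<close>)
qed

text \<open>It serves binary connectives and also mixed quantifier blocks, which compare the
  quantifier first and the body second.\<close>

lemma ordered_carrier_lex_prod:
  assumes "ordered_carrier A r" and "ordered_carrier B s"
  shows "ordered_carrier (A \<times> B)
    (\<lambda>p p'. strict r (fst p) (fst p') \<or> fst p = fst p' \<and> s (snd p) (snd p'))"
proof -
  interpret A: ordered_carrier A r by fact
  interpret B: ordered_carrier B s by fact
  show ?thesis
  proof
    fix p assume "p \<in> A \<times> B"
    then show "strict r (fst p) (fst p) \<or> fst p = fst p \<and> s (snd p) (snd p)"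
      using B.le_refl by auto
  next
    fix p p' assume p: "p \<in> A \<times> B" "p' \<in> A \<times> B"
      and le: "strict r (fst p) (fst p') \<or> fst p = fst p' \<and> s (snd p) (snd p')"
        "strict r (fst p') (fst p) \<or> fst p' = fst p \<and> s (snd p') (snd p)"
    then have "fst p = fst p'" using A.strict_asym[of "fst p" "fst p'"] by auto
    moreover from this have "snd p = snd p'"
      using le p B.le_antisym[of "snd p" "snd p'"] by (auto simp: strict_def)
    ultimately show "p = p'" by (simp add: prod_eq_iff)
  next
    fix p p' p'' assume p: "p \<in> A \<times> B" "p' \<in> A \<times> B" "p'' \<in> A \<times> B"
      and le: "strict r (fst p) (fst p') \<or> fst p = fst p' \<and> s (snd p) (snd p')"
        "strict r (fst p') (fst p'') \<or> fst p' = fst p'' \<and> s (snd p') (snd p'')"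
    have "fst p \<in> A" "fst p' \<in> A" "fst p'' \<in> A" "snd p \<in> B" "snd p' \<in> B" "snd p'' \<in> B"
      using p by auto
    then show "strict r (fst p) (fst p'') \<or> fst p = fst p'' \<and> s (snd p) (snd p'')"
      using le A.strict_trans[of "fst p" "fst p'" "fst p''"]
        B.le_trans[of "snd p" "snd p'" "snd p''"] by metis
  next
    fix p p' assume p: "p \<in> A \<times> B" "p' \<in> A \<times> B"
    then have "fst p \<in> A" "fst p' \<in> A" by auto
    then consider "strict r (fst p) (fst p')" | "fst p = fst p'" | "strict r (fst p') (fst p)"
      by (rule A.strict_cases)
    then show "(strict r (fst p) (fst p') \<or> fst p = fst p' \<and> s (snd p) (snd p'))
      \<or> (strict r (fst p') (fst p) \<or> fst p' = fst p \<and> s (snd p') (snd p))"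
      using p B.le_total[of "snd p" "snd p'"] by cases auto
  qed
qed

text \<open>Everything is componentwise except the order, and a componentwise comparison implies the
  lexicographic one.\<close>

lemma canon_lang_LBin:
  assumes "canon_lang ord L1" and "canon_lang ord L2"
  shows "canon_lang ord (LBin c L1 L2)"
proof -
  interpret A: canon_system "formulas L1" "subsumes L1" "lang_le ord L1" "canon ord L1" by fact
  interpret B: canon_system "formulas L2" "subsumes L2" "lang_le ord L2" "canon ord L2" by fact
  let ?S = "(\<lambda>p. Bin c (fst p) (snd p)) ` (A.C \<times> B.C)"
  show ?thesis
  proof (rule canon_systemI[where S = ?S])
    show "ordered_carrier ?S (lang_le ord (LBin c L1 L2))"
      by (rule ordered_carrier_image[OF ordered_carrier_lex_prod])
        (use A.ordered_carrier_axioms B.ordered_carrier_axioms in auto)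
  next
    fix x assume "x \<in> formulas (LBin c L1 L2)"
    then show "canon ord (LBin c L1 L2) x \<in> ?S" using A.c_in_C B.c_in_C by force
  next
    fix x y z assume "x \<in> formulas (LBin c L1 L2)" "y \<in> formulas (LBin c L1 L2)"
      "z \<in> formulas (LBin c L1 L2)" "subsumes (LBin c L1 L2) x y" "subsumes (LBin c L1 L2) y z"
    then show "subsumes (LBin c L1 L2) x z" by (auto intro: A.sub_trans B.sub_trans)
  next
    fix x y assume "x \<in> ?S" "y \<in> ?S" "subsumes (LBin c L1 L2) x y"
    then show "lang_le ord (LBin c L1 L2) x y"
      using A.sub_imp_le B.sub_imp_le by (auto simp: strict_def)
  qed (auto simp: A.sub_refl B.sub_refl A.c_sub B.c_sub A.sub_c B.sub_c)
qed

section \<open>Bounded disjunctions\<close>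

text \<open>This separates the matching from the syntax of disjunctions, so that matchings can be
  composed for lists over any relation.\<close>

definition injects :: "('a \<Rightarrow> 'a \<Rightarrow> bool) \<Rightarrow> 'a list \<Rightarrow> 'a list \<Rightarrow> bool" where
  "injects R xs ys \<longleftrightarrow>
     (\<exists>m. inj_on m {..<length xs} \<and> m ` {..<length xs} \<subseteq> {..<length ys} \<and>
          (\<forall>i<length xs. R (xs ! i) (ys ! m i)))"

lemma subsumes_BigOr: "subsumes (LBigOr k L) (BigOr xs) (BigOr ys) \<longleftrightarrow> injects (subsumes L) xs ys"
  by (simp add: injects_def)

lemma injects_trans:
  assumes "injects R xs ys" "injects R ys zs"
    and trans: "\<And>x y z. \<lbrakk>x \<in> set xs; y \<in> set ys; z \<in> set zs; R x y; R y z\<rbrakk> \<Longrightarrow> R x z"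
  shows "injects R xs zs"
proof -
  obtain m where m: "inj_on m {..<length xs}" "m ` {..<length xs} \<subseteq> {..<length ys}"
      "\<And>i. i < length xs \<Longrightarrow> R (xs ! i) (ys ! m i)"
    using assms(1) unfolding injects_def by blast
  obtain n where n: "inj_on n {..<length ys}" "n ` {..<length ys} \<subseteq> {..<length zs}"
      "\<And>i. i < length ys \<Longrightarrow> R (ys ! i) (zs ! n i)"
    using assms(2) unfolding injects_def by blast
  have "R (xs ! i) (zs ! n (m i))" if "i < length xs" for i
  proof (rule trans)
    have *: "m i < length ys" using m(2) that by auto
    then have "n (m i) < length zs" using n(2) by auto
    with * that show "xs ! i \<in> set xs" "ys ! m i \<in> set ys" "zs ! n (m i) \<in> set zs" by auto
    show "R (xs ! i) (ys ! m i)" "R (ys ! m i) (zs ! n (m i))" using m(3) n(3) * that by auto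
  qed
  moreover have "inj_on (n \<circ> m) {..<length xs}"
    using comp_inj_on[OF m(1)] inj_on_subset[OF n(1) m(2)] by blast
  moreover have "(n \<circ> m) ` {..<length xs} \<subseteq> {..<length zs}"
    using m(2) n(2) by fastforce
  ultimately show ?thesis unfolding injects_def by (intro exI[of _ "n \<circ> m"]) simp
qed

lemma injects_pointwise:
  assumes "length xs = length ys" and "\<And>i. i < length xs \<Longrightarrow> R (xs ! i) (ys ! i)"
  shows "injects R xs ys"
  unfolding injects_def by (rule exI[of _ id]) (use assms in auto)

text \<open>The permutation relating two lists with the same multiset is itself the matching; it
  pairs equal entries, so reflexivity suffices.\<close>

lemma injects_mset_eq:
  assumes "mset xs = mset ys" and "\<And>x. x \<in> set xs \<Longrightarrow> R x x"
  shows "injects R xs ys"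
proof -
  obtain p where p: "p permutes {..<length ys}" "permute_list p ys = xs"
    using mset_eq_permutation[OF assms(1)] by blast
  have len: "length xs = length ys" using assms(1) by (rule mset_eq_length)
  have "R (xs ! i) (ys ! p i)" if "i < length xs" for i
    using permute_list_nth[OF p(1), of i] p(2) that len assms(2)[OF nth_mem[OF that]] by simp
  then show ?thesis unfolding injects_def
    using permutes_inj_on[OF p(1)] permutes_image[OF p(1)] len by (intro exI[of _ p]) simp
qed

text \<open>Sorted sequences of canonical formulas form the carrier. A matching between two of them
  implies the comparison from the largest entry downwards, so the order extends subsumption.\<close>

lemma canon_lang_LBigOr:
  assumes "canon_lang ord L"
  shows "canon_lang ord (LBigOr k L)"
proof -
  let ?F = "formulas L" and ?R = "subsumes L" and ?le = "lang_le ord L" and ?c = "canon ord L"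
  interpret canon_system ?F ?R ?le ?c by fact
  let ?S = "BigOr ` {xs \<in> lists C. sorted_wrt ?le xs \<and> length xs \<le> k}"
  let ?sort = "\<lambda>xs. sort_by ?le (mset (map ?c xs))"
  have sort: "mset (?sort xs) = mset (map ?c xs)" "sorted_wrt ?le (?sort xs)"
    "length (?sort xs) = length xs" "set (?sort xs) = ?c ` set xs"
    if "xs \<in> lists ?F" for xs
  proof -
    have "set_mset (mset (map ?c xs)) \<subseteq> C" using that c_in_C by auto
    from sort_by[OF this] show *: "mset (?sort xs) = mset (map ?c xs)" "sorted_wrt ?le (?sort xs)"
      by auto
    from mset_eq_length[OF *(1)] mset_eq_setD[OF *(1)]
    show "length (?sort xs) = length xs" "set (?sort xs) = ?c ` set xs" by auto
  qed
  have trans: "injects ?R xs zs"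
    if "xs \<in> lists ?F" "ys \<in> lists ?F" "zs \<in> lists ?F" "injects ?R xs ys" "injects ?R ys zs"
    for xs ys zs
    by (rule injects_trans[OF that(4,5)]) (use that(1-3) sub_trans in blast)
  have refl: "injects ?R xs xs" if "xs \<in> lists ?F" for xs
    by (rule injects_mset_eq) (use that sub_refl in auto)
  \<comment> \<open>The link is \<open>map ?c xs\<close>: sorting only permutes it, and its entries
    are equivalent to those of \<open>xs\<close>.\<close>
  have sort_equiv: "injects ?R (?sort xs) xs" "injects ?R xs (?sort xs)" if xs: "xs \<in> lists ?F" for xs
  proof -
    have F: "map ?c xs \<in> lists ?F" "?sort xs \<in> lists ?F"
      using xs c_closed sort(4)[OF xs] by auto
    have nth: "xs ! i \<in> ?F" if "i < length xs" for i using xs that by auto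
    have "injects ?R (?sort xs) (map ?c xs)" "injects ?R (map ?c xs) (?sort xs)"
      using sort(1)[OF xs] F sub_refl by (auto intro!: injects_mset_eq simp del: mset_map)
    moreover have "injects ?R (map ?c xs) xs" "injects ?R xs (map ?c xs)"
      using nth c_sub sub_c by (auto intro!: injects_pointwise)
    ultimately show "injects ?R (?sort xs) xs" "injects ?R xs (?sort xs)"
      using trans F xs by blast+
  qed
  have le: "lang_le ord (LBigOr k L) (BigOr xs) (BigOr ys) \<longleftrightarrow> prefix_lex ?le (rev xs) (rev ys)"
    for xs ys by (simp add: prefix_lex_def suffix_to_prefix)
  show ?thesis
  proof (rule canon_systemI[where S = ?S])
    \<comment> \<open>The order reads disjunctions from the last entry, so the carrier is embedded
      into the image of reversed lists, where \<open>prefix_lex\<close> is known to be a total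
      order.\<close>
    have "?S \<subseteq> (BigOr \<circ> rev) ` lists C"
    proof
      fix x assume "x \<in> ?S"
      then obtain xs where "x = BigOr xs" "xs \<in> lists C" by blast
      then have "x = (BigOr \<circ> rev) (rev xs)" "rev xs \<in> lists C" by auto
      then show "x \<in> (BigOr \<circ> rev) ` lists C" by (rule image_eqI)
    qed
    moreover have "ordered_carrier ((BigOr \<circ> rev) ` lists C) (lang_le ord (LBigOr k L))"
      by (rule ordered_carrier_image[OF ordered_carrier_prefix_lex]) (simp only: comp_apply le rev_rev_ident)
    ultimately show "ordered_carrier ?S (lang_le ord (LBigOr k L))"
      by (rule ordered_carrier_mono[rotated])
  next
    fix x assume "x \<in> formulas (LBigOr k L)"
    then obtain xs where xs: "x = BigOr xs" "xs \<in> lists ?F" "length xs \<le> k" by auto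
    have "?sort xs \<in> lists C" using sort(4)[OF xs(2)] xs(2) c_in_C by auto
    then show "canon ord (LBigOr k L) x \<in> ?S" using xs sort by (auto simp del: mset_map)
    show "subsumes (LBigOr k L) (canon ord (LBigOr k L) x) x"
      "subsumes (LBigOr k L) x (canon ord (LBigOr k L) x)"
      "subsumes (LBigOr k L) x x"
      using xs sort_equiv[OF xs(2)] refl[OF xs(2)]
      by (simp_all only: canon.simps fm.simps subsumes_BigOr)
  next
    fix x y z assume "x \<in> formulas (LBigOr k L)" "y \<in> formulas (LBigOr k L)"
      "z \<in> formulas (LBigOr k L)" and sub: "subsumes (LBigOr k L) x y" "subsumes (LBigOr k L) y z"
    then obtain xs ys zs where *: "x = BigOr xs" "y = BigOr ys" "z = BigOr zs"
      "xs \<in> lists ?F" "ys \<in> lists ?F" "zs \<in> lists ?F"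
      by auto
    show "subsumes (LBigOr k L) x z"
      using trans[OF *(4-6)] sub unfolding *(1-3) subsumes_BigOr by blast
  next
    fix x y assume "x \<in> ?S" "y \<in> ?S" and sub: "subsumes (LBigOr k L) x y"
    then obtain xs ys where x: "x = BigOr xs" "set xs \<subseteq> C" "sorted_wrt ?le xs"
      and y: "y = BigOr ys" "set ys \<subseteq> C" "sorted_wrt ?le ys" by blast
    from sub obtain m where m: "inj_on m {..<length xs}" "m ` {..<length xs} \<subseteq> {..<length ys}"
      "\<And>i. i < length xs \<Longrightarrow> ?R (xs ! i) (ys ! m i)"
      unfolding x(1) y(1) subsumes_BigOr injects_def by blast
    have "prefix_lex ?le (rev xs) (rev ys)"
    proof (rule matching_imp_prefix_lex_rev[OF x(2,3) y(2,3) m(1,2)])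
      fix i assume i: "i < length xs"
      then have "m i < length ys" using m(2) by auto
      then have "xs ! i \<in> C" "ys ! m i \<in> C" using i x(2) y(2) nth_mem by blast+
      then show "?le (xs ! i) (ys ! m i)" using m(3)[OF i] sub_imp_le by simp
    qed
    then show "lang_le ord (LBigOr k L) x y" using x y le by simp
  qed auto
qed

section \<open>Unbounded conjunctions\<close>

text \<open>The index map need not be injective, so it is just a choice function and only the sets
  of conjuncts matter.\<close>

lemma subsumes_BigAnd:
  "subsumes (LBigAnd L) (BigAnd xs) (BigAnd ys) \<longleftrightarrow> (\<forall>y\<in>set ys. \<exists>x\<in>set xs. subsumes L x y)"
proof
  assume "subsumes (LBigAnd L) (BigAnd xs) (BigAnd ys)"
  then obtain m where "m ` {..<length ys} \<subseteq> {..<length xs}"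
      "\<forall>i<length ys. subsumes L (xs ! m i) (ys ! i)" by auto
  then show "\<forall>y\<in>set ys. \<exists>x\<in>set xs. subsumes L x y"
    unfolding set_conv_nth by (fastforce simp: image_subset_iff)
next
  assume *: "\<forall>y\<in>set ys. \<exists>x\<in>set xs. subsumes L x y"
  have "\<forall>i. \<exists>j. i < length ys \<longrightarrow> j < length xs \<and> subsumes L (xs ! j) (ys ! i)"
    using * by (metis in_set_conv_nth)
  then obtain m where "\<And>i. i < length ys \<Longrightarrow> m i < length xs \<and> subsumes L (xs ! m i) (ys ! i)"
    by metis
  then show "subsumes (LBigAnd L) (BigAnd xs) (BigAnd ys)"
    by (auto intro!: exI[of _ m])
qed

context canon_system
begin

text \<open>Among the elements that subsume \<open>x\<close>, take the \<open>le\<close>-least one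
  \<open>m\<close>. Anything subsuming \<open>m\<close> also subsumes \<open>x\<close>, so it lies
  above \<open>m\<close> in \<open>le\<close>; it lies below \<open>m\<close> because
  \<open>le\<close> extends \<open>sub\<close>, hence it equals \<open>m\<close>.\<close>

lemma minimal_elem_below:
  assumes A: "finite A" "A \<subseteq> C" and x: "x \<in> A"
  shows "\<exists>m\<in>minimal_elems sub A. sub m x"
proof -
  let ?B = "{y \<in> A. sub y x}"
  have "finite ?B" "?B \<noteq> {}" "?B \<subseteq> C" using A x sub_refl by auto
  from ex_least[OF this] obtain m where m: "m \<in> A" "sub m x" "\<And>y. y \<in> ?B \<Longrightarrow> le m y" by auto
  have "z = m" if z: "z \<in> A" "sub z m" for z
  proof -
    have C: "z \<in> C" "m \<in> C" "x \<in> C" using A z m x by auto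
    then have "sub z x" using sub_trans[of z m x] z m by simp
    then have "le m z" using m(3) z by simp
    moreover have "le z m" using sub_imp_le C z(2) by simp
    ultimately show ?thesis using le_antisym C by blast
  qed
  then show ?thesis using m unfolding minimal_elems_def by blast
qed

text \<open>
  At the first difference, the element \<open>y\<close> of \<open>ys\<close> is subsumed by some \<open>z\<close> of \<open>ps @ xs\<close>. As \<open>ps @ ys\<close>
  is an antichain, \<open>z\<close> is not in the common prefix \<open>ps\<close>, so the first element of \<open>xs\<close> is \<open>\<le> z \<le> y\<close>.
\<close>

lemma antichains_extension_lex:
  assumes "set (ps @ xs) \<subseteq> C" "set (ps @ ys) \<subseteq> C" "sorted_wrt le xs" "distinct (ps @ ys)"
    and "\<And>x y. \<lbrakk>x \<in> set (ps @ ys); y \<in> set (ps @ ys); sub x y\<rbrakk> \<Longrightarrow> x = y"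
    and "\<And>y. y \<in> set ys \<Longrightarrow> \<exists>x\<in>set (ps @ xs). sub x y"
  shows "extension_lex le xs ys"
  using assms
proof (induction ys arbitrary: ps xs)
  case (Cons y ys)
  obtain z where z: "z \<in> set (ps @ xs)" "sub z y" using Cons.prems(6)[of y] by auto
  have "z \<notin> set ps" using Cons.prems(5)[of z y] Cons.prems(4) z(2) by auto
  with z obtain x xs' where xs: "xs = x # xs'" by (cases xs) auto
  have C: "x \<in> C" "y \<in> C" "z \<in> C" using Cons.prems(1,2) xs z(1) by auto
  have "z = x \<or> le x z" using z(1) \<open>z \<notin> set ps\<close> Cons.prems(3) xs by auto
  moreover have "le z y" using sub_imp_le C z(2) by simp
  ultimately have "le x y" using le_trans[of x z y] C by blast
  moreover have "extension_lex le xs' ys" if "x = y"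
  proof (rule Cons.IH[of "ps @ [y]"])
    fix u assume "u \<in> set ys"
    then show "\<exists>x\<in>set ((ps @ [y]) @ xs'). sub x u" using Cons.prems(6)[of u] xs that by auto
  next
    fix u v assume "u \<in> set ((ps @ [y]) @ ys)" "v \<in> set ((ps @ [y]) @ ys)" "sub u v"
    then show "u = v" using Cons.prems(5)[of u v] by simp
  qed (use Cons.prems(1-4) xs that in auto)
  ultimately show ?case using xs by (auto simp: strict_def)
qed simp

end

text \<open>Non-minimal conjuncts are redundant, as each is subsumed by a retained one. Nonempty
  sorted antichains form the carrier, and the comparison of antichains shows that the order extends
  subsumption.\<close>

lemma canon_lang_LBigAnd:
  assumes "canon_lang ord L"
  shows "canon_lang ord (LBigAnd L)"
proof -
  let ?F = "formulas L" and ?R = "subsumes L" and ?le = "lang_le ord L" and ?c = "canon ord L"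
  interpret canon_system ?F ?R ?le ?c by fact
  let ?S = "BigAnd ` {xs \<in> lists C. xs \<noteq> [] \<and> sorted_wrt ?le xs \<and> distinct xs \<and>
    (\<forall>x\<in>set xs. \<forall>y\<in>set xs. ?R x y \<longrightarrow> x = y)}"
  let ?min = "\<lambda>xs. minimal_elems ?R (set (map ?c xs))"
  let ?sort = "\<lambda>xs. sort_by ?le (mset_set (?min xs))"
  have min: "finite (?min xs)" "?min xs \<subseteq> ?c ` set xs" for xs
    by (auto simp: minimal_elems_def)
  have sort: "set (?sort xs) = ?min xs" "distinct (?sort xs)" "sorted_wrt ?le (?sort xs)"
    if "xs \<in> lists ?F" for xs
  proof -
    have "set_mset (mset_set (?min xs)) \<subseteq> C"
      using that c_in_C min[of xs] by auto
    note * = sort_by[OF this]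
    from *(2) show "sorted_wrt ?le (?sort xs)" .
    from arg_cong[OF *(1), of set_mset] show set: "set (?sort xs) = ?min xs"
      using min(1)[of xs] by simp
    \<comment> \<open>\<open>mset_set\<close> gives every minimal element multiplicity one.\<close>
    show "distinct (?sort xs)"
      unfolding distinct_count_atmost_1 *(1) set using min(1)[of xs] by simp
  qed
  have below: "\<exists>m\<in>?min xs. ?R m (?c x)" if "xs \<in> lists ?F" "x \<in> set xs" for xs x
    by (rule minimal_elem_below) (use that c_in_C in auto)
  have le: "lang_le ord (LBigAnd L) (BigAnd xs) (BigAnd ys) \<longleftrightarrow> extension_lex ?le xs ys"
    for xs ys by (simp add: extension_lex_def)
  show ?thesis
  proof (rule canon_systemI[where S = ?S])
    have "ordered_carrier (BigAnd ` lists C) (lang_le ord (LBigAnd L))"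
      by (rule ordered_carrier_image[OF ordered_carrier_extension_lex]) (simp only: le)
    then show "ordered_carrier ?S (lang_le ord (LBigAnd L))"
      by (rule ordered_carrier_mono) blast
  next
    fix x assume "x \<in> formulas (LBigAnd L)"
    then obtain xs where xs: "x = BigAnd xs" "xs \<in> lists ?F" "xs \<noteq> []" by auto
    have canon_x: "canon ord (LBigAnd L) x = BigAnd (?sort xs)" using xs by simp
    have "?sort xs \<in> lists C" using sort(1)[OF xs(2)] min(2)[of xs] xs(2) c_in_C by auto
    \<comment> \<open>The language excludes the empty conjunction; a minimal element below the form
      of the first conjunct shows that something is retained.\<close>
    moreover have "?sort xs \<noteq> []"
    proof -
      have "?min xs \<noteq> {}" using below[OF xs(2), of "hd xs"] xs(3) by auto
      then show ?thesis using sort(1)[OF xs(2)] by (metis list.set(1))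
    qed
    moreover have "\<forall>x\<in>set (?sort xs). \<forall>y\<in>set (?sort xs). ?R x y \<longrightarrow> x = y"
      unfolding sort(1)[OF xs(2)] by (auto simp: minimal_elems_def)
    ultimately show "canon ord (LBigAnd L) x \<in> ?S"
      unfolding canon_x using sort(2,3)[OF xs(2)] by blast
    \<comment> \<open>A retained form \<open>m\<close> subsumes \<open>?c y\<close>, which subsumes
      \<open>y\<close>.\<close>
    have "\<exists>z\<in>set (?sort xs). ?R z y" if y: "y \<in> set xs" for y
    proof -
      obtain m where m: "m \<in> ?min xs" "?R m (?c y)" using below xs(2) y by blast
      have "y \<in> ?F" "m \<in> ?F" using m(1) min(2)[of xs] xs(2) y c_closed by auto
      then have "?R m y" using m(2) sub_trans[of m "?c y" y] c_closed c_sub by blast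
      then show ?thesis using m(1) sort(1)[OF xs(2)] by blast
    qed
    then show "subsumes (LBigAnd L) (canon ord (LBigAnd L) x) x"
      unfolding canon_x unfolding xs(1) subsumes_BigAnd by blast
    have "\<exists>y\<in>set xs. ?R y z" if z: "z \<in> set (?sort xs)" for z
    proof -
      obtain y where "y \<in> set xs" "z = ?c y" using z min(2)[of xs] sort(1)[OF xs(2)] by blast
      then show ?thesis using xs(2) sub_c by auto
    qed
    then show "subsumes (LBigAnd L) x (canon ord (LBigAnd L) x)"
      unfolding canon_x unfolding xs(1) subsumes_BigAnd by blast
    show "subsumes (LBigAnd L) x x"
      unfolding xs(1) subsumes_BigAnd using xs(2) sub_refl by blast
  next
    fix x y z assume "x \<in> formulas (LBigAnd L)" "y \<in> formulas (LBigAnd L)"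
      "z \<in> formulas (LBigAnd L)" and sub: "subsumes (LBigAnd L) x y" "subsumes (LBigAnd L) y z"
    then obtain xs ys zs where *: "x = BigAnd xs" "y = BigAnd ys" "z = BigAnd zs"
      "xs \<in> lists ?F" "ys \<in> lists ?F" "zs \<in> lists ?F"
      by auto
    show "subsumes (LBigAnd L) x z"
      unfolding * subsumes_BigAnd
    proof
      fix w assume w: "w \<in> set zs"
      then obtain v where v: "v \<in> set ys" "?R v w" using sub(2) unfolding * subsumes_BigAnd by blast
      then obtain u where u: "u \<in> set xs" "?R u v" using sub(1) unfolding * subsumes_BigAnd by blast
      then show "\<exists>u\<in>set xs. ?R u w" using sub_trans[of u v w] u v w *(4-6) by blast
    qed
  next
    fix x y assume "x \<in> ?S" "y \<in> ?S" and sub: "subsumes (LBigAnd L) x y"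
    then obtain xs ys where x: "x = BigAnd xs" "set xs \<subseteq> C" "sorted_wrt ?le xs"
      and y: "y = BigAnd ys" "set ys \<subseteq> C" "distinct ys"
        "\<And>x y. \<lbrakk>x \<in> set ys; y \<in> set ys; ?R x y\<rbrakk> \<Longrightarrow> x = y" by blast
    have "\<forall>y\<in>set ys. \<exists>x\<in>set xs. ?R x y" using sub unfolding x(1) y(1) subsumes_BigAnd .
    then have "extension_lex ?le xs ys"
      using antichains_extension_lex[of "[]" xs ys] x y by simp
    then show "lang_le ord (LBigAnd L) x y" using x y le by simp
  qed auto
qed

section \<open>Quantifier blocks\<close>

text \<open>The quantifier is stripped off so that plain and mixed blocks share one argument about
  bodies.\<close>

definition block_sub ::
    "'v set \<Rightarrow> ('f, 'p, 'v) lang \<Rightarrow> ('f, 'p, 'v) fm \<Rightarrow> ('f, 'p, 'v) fm \<Rightarrow> bool" where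
  "block_sub X L \<phi> \<psi> \<longleftrightarrow> (\<exists>\<pi>. \<pi> permutes X \<and> subsumes L \<phi> (subst \<pi> \<psi>))"

definition block_canon ::
    "('f, 'p, 'v) base_order \<Rightarrow> 'v set \<Rightarrow> ('f, 'p, 'v) lang \<Rightarrow> ('f, 'p, 'v) fm \<Rightarrow> ('f, 'p, 'v) fm" where
  "block_canon ord X L \<phi> =
     least_elem (lang_le ord L) {canon ord L (subst \<pi> \<phi>) | \<pi>. \<pi> permutes X}"

text \<open>Bodies matter only through their orbits under permutations of \<open>X\<close>, which
  are finite because \<open>X\<close> is. Since permuting preserves subsumption, the
  \<open>le\<close>-least canonical form in the orbit is a canonical representative, and the carrier
  consists of the canonical bodies that are least in their own orbit.\<close>

lemma canon_system_block:
  assumes "canon_lang ord L" "bounded_lang \<Sigma> V L" "finite X" "X \<subseteq> V" "substitutable X (formulas L)"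
  shows "canon_system (formulas L) (block_sub X L) (lang_le ord L) (block_canon ord X L)"
proof -
  let ?F = "formulas L" and ?R = "subsumes L" and ?le = "lang_le ord L" and ?c = "canon ord L"
  interpret canon_system ?F ?R ?le ?c by fact
  let ?orbit = "\<lambda>\<phi>. {?c (subst \<pi> \<phi>) | \<pi>. \<pi> permutes X}"
  let ?S = "{\<phi> \<in> C. \<forall>\<pi>. \<pi> permutes X \<longrightarrow> ?le \<phi> (?c (subst \<pi> \<phi>))}"
  note closed = subst_closed[OF assms(2-5)]
  note mono = subsumes_subst[OF assms(2-5)]
  have comp: "subst \<pi> (subst \<sigma> \<phi>) = subst (\<pi> \<circ> \<sigma>) \<phi>" if "\<sigma> permutes X" "\<phi> \<in> ?F" for \<pi> \<sigma> \<phi>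
    using assms(5) that by (simp add: subst_subst substitutable_def)
  have inv: "subst (inv \<pi>) (subst \<pi> \<phi>) = \<phi>" if "\<pi> permutes X" "\<phi> \<in> ?F" for \<pi> \<phi>
    using comp[OF that] that(1) by (simp add: permutes_inv_o subst_id)
  have least: "block_canon ord X L \<phi> \<in> ?orbit \<phi>"
    "\<And>\<pi>. \<pi> permutes X \<Longrightarrow> ?le (block_canon ord X L \<phi>) (?c (subst \<pi> \<phi>))"
    if "\<phi> \<in> ?F" for \<phi>
  proof -
    have orbit: "?orbit \<phi> = (\<lambda>\<pi>. ?c (subst \<pi> \<phi>)) ` {\<pi>. \<pi> permutes X}" by auto
    have *: "finite (?orbit \<phi>)" "?orbit \<phi> \<noteq> {}" "?orbit \<phi> \<subseteq> C"
      unfolding orbit using finite_permutations[OF assms(3)] permutes_id[of X]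
        c_in_C closed[OF _ that] by blast+
    show "block_canon ord X L \<phi> \<in> ?orbit \<phi>"
      unfolding block_canon_def by (rule least_elem(1)[OF *])
    show "?le (block_canon ord X L \<phi>) (?c (subst \<pi> \<phi>))" if "\<pi> permutes X" for \<pi>
      unfolding block_canon_def by (rule least_elem(2)[OF *]) (use that in blast)
  qed
  \<comment> \<open>\<open>\<phi>\<close> and \<open>?c \<phi>\<close> stay equivalent after
    applying \<open>\<rho>\<close>, so canonicalizing before permuting does not change the final
    form.\<close>
  have c_subst: "?c (subst \<rho> (?c \<phi>)) = ?c (subst \<rho> \<phi>)" if "\<phi> \<in> ?F" "\<rho> permutes X" for \<phi> \<rho>
    by (rule c_cong) (use that closed c_closed c_sub sub_c mono in blast)+
  show ?thesis
  proof (rule canon_systemI[where S = ?S])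
    fix \<phi> assume \<phi>: "\<phi> \<in> ?F"
    show "block_sub X L \<phi> \<phi>"
      unfolding block_sub_def using sub_refl[OF \<phi>] permutes_id[of X] subst_id[of \<phi>] by metis
    obtain \<pi> where \<pi>: "\<pi> permutes X" "block_canon ord X L \<phi> = ?c (subst \<pi> \<phi>)"
      using least(1)[OF \<phi>] by blast
    have "subst \<pi> \<phi> \<in> ?F" using closed \<pi>(1) \<phi> .
    note F = this c_closed[OF this] and equiv = c_sub[OF this] sub_c[OF this]
    \<comment> \<open>Permuted copies of the chosen representative canonicalize to members of the
      orbit of \<open>\<phi>\<close>, so minimality there carries over.\<close>
    have "?c (subst \<rho> (?c (subst \<pi> \<phi>))) = ?c (subst (\<rho> \<circ> \<pi>) \<phi>)" if "\<rho> permutes X" for \<rho>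
      using c_subst[OF F(1) that] comp[OF \<pi>(1) \<phi>] by simp
    then have "?le (block_canon ord X L \<phi>) (?c (subst \<rho> (block_canon ord X L \<phi>)))"
      if "\<rho> permutes X" for \<rho>
      using least(2)[OF \<phi> permutes_compose[OF \<pi>(1) that]] that \<pi>(2) by simp
    moreover have "block_canon ord X L \<phi> \<in> C" unfolding \<pi>(2) by (rule c_in_C[OF F(1)])
    ultimately show "block_canon ord X L \<phi> \<in> ?S" by blast
    show "block_sub X L (block_canon ord X L \<phi>) \<phi>"
      unfolding block_sub_def \<pi>(2) using \<pi>(1) equiv(1) by blast
    \<comment> \<open>Undoing \<open>\<pi>\<close> on \<open>subst \<pi> \<phi>\<close> and on its
      canonical form exhibits the inverse permutation as witness.\<close>
    have "?R \<phi> (subst (inv \<pi>) (?c (subst \<pi> \<phi>)))"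
      using mono[OF permutes_inv[OF \<pi>(1)] F equiv(2)] inv[OF \<pi>(1) \<phi>] by simp
    then show "block_sub X L \<phi> (block_canon ord X L \<phi>)"
      unfolding block_sub_def \<pi>(2) using permutes_inv[OF \<pi>(1)] by blast
  next
    fix \<phi> \<psi> \<chi> assume F: "\<phi> \<in> ?F" "\<psi> \<in> ?F" "\<chi> \<in> ?F"
      and sub: "block_sub X L \<phi> \<psi>" "block_sub X L \<psi> \<chi>"
    obtain \<pi> \<rho> where \<pi>: "\<pi> permutes X" "?R \<phi> (subst \<pi> \<psi>)" and \<rho>: "\<rho> permutes X" "?R \<psi> (subst \<rho> \<chi>)"
      using sub unfolding block_sub_def by blast
    have "?R (subst \<pi> \<psi>) (subst \<pi> (subst \<rho> \<chi>))"
      using mono[OF \<pi>(1) F(2) _ \<rho>(2)] closed \<rho>(1) F(3) by blast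
    then have "?R \<phi> (subst \<pi> (subst \<rho> \<chi>))"
      using sub_trans[OF F(1) _ _ \<pi>(2)] closed \<pi>(1) \<rho>(1) F by blast
    then show "block_sub X L \<phi> \<chi>"
      unfolding block_sub_def comp[OF \<rho>(1) F(3)] using permutes_compose[OF \<rho>(1) \<pi>(1)] by blast
  next
    show "ordered_carrier ?S ?le" by (rule ordered_carrier_mono[OF ordered_carrier_axioms]) blast
  next
    fix \<phi> \<psi> assume S: "\<phi> \<in> ?S" "\<psi> \<in> ?S" and "block_sub X L \<phi> \<psi>"
    then obtain \<pi> where \<pi>: "\<pi> permutes X" "?R \<phi> (subst \<pi> \<psi>)" unfolding block_sub_def by blast
    have C: "\<phi> \<in> C" "\<psi> \<in> C" using S by auto
    \<comment> \<open>Moving \<open>\<pi>\<close> to the left makes \<open>?\<phi>'\<close> subsume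
      \<open>\<psi>\<close>. Its canonical form is then \<open>\<le> \<psi>\<close>, and
      \<open>\<phi>\<close> is below that form by minimality in its orbit.\<close>
    let ?\<phi>' = "subst (inv \<pi>) \<phi>"
    have \<phi>': "?\<phi>' \<in> ?F" using closed[OF permutes_inv[OF \<pi>(1)]] C by blast
    have "?R ?\<phi>' (subst (inv \<pi>) (subst \<pi> \<psi>))"
      using mono[OF permutes_inv[OF \<pi>(1)] _ _ \<pi>(2)] closed[OF \<pi>(1)] C by blast
    then have "?R ?\<phi>' \<psi>" using inv[OF \<pi>(1)] C by simp
    then have "?R (?c ?\<phi>') \<psi>" using sub_trans[OF c_closed[OF \<phi>'] \<phi>' _ c_sub[OF \<phi>']] C by blast
    then have "?le (?c ?\<phi>') \<psi>" using sub_imp_le c_in_C[OF \<phi>'] C by simp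
    moreover have "?le \<phi> (?c ?\<phi>')" using S(1) permutes_inv[OF \<pi>(1)] by blast
    ultimately show "?le \<phi> \<psi>" using le_trans c_in_C[OF \<phi>'] C by blast
  qed auto
qed

lemma canon_lang_LQuant:
  assumes "canon_lang ord L" "bounded_lang \<Sigma> V (LQuant q X L)"
  shows "canon_lang ord (LQuant q X L)"
proof -
  interpret canon_system "formulas L" "block_sub X L" "lang_le ord L" "block_canon ord X L"
    by (rule canon_system_block) (use assms in auto)
  let ?L = "LQuant q X L"
  have sub: "subsumes ?L (Quant q1 X1 \<phi>) (Quant q2 X2 \<psi>) \<longleftrightarrow> block_sub X L \<phi> \<psi>" for q1 X1 q2 X2 \<phi> \<psi>
    by (simp add: block_sub_def)
  have canon: "canon ord ?L (Quant q1 X1 \<phi>) = Quant q1 X1 (block_canon ord X L \<phi>)" for q1 X1 \<phi>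
    by (simp add: block_canon_def)
  have formulas: "formulas ?L = Quant q X ` formulas L" by auto
  show ?thesis
    unfolding formulas
  proof (rule canon_systemI[where S = "Quant q X ` C"])
    show "ordered_carrier (Quant q X ` C) (lang_le ord ?L)"
      by (rule ordered_carrier_image[OF ordered_carrier_axioms]) simp
  next
    fix x y z assume "x \<in> Quant q X ` formulas L" "y \<in> Quant q X ` formulas L"
      "z \<in> Quant q X ` formulas L" "subsumes ?L x y" "subsumes ?L y z"
    then show "subsumes ?L x z" using sub sub_trans by blast
  next
    fix x assume "x \<in> Quant q X ` formulas L"
    then show "canon ord ?L x \<in> Quant q X ` C" using canon c_in_C by blast
  next
    fix x y assume "x \<in> Quant q X ` C" "y \<in> Quant q X ` C" "subsumes ?L x y"
    then show "lang_le ord ?L x y" using sub sub_imp_le by auto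
  qed (auto simp: sub canon sub_refl c_sub sub_c simp del: subsumes.simps canon.simps)
qed

text \<open>This is the two-element chain with \<open>Forall\<close> at the bottom, written as the
  side condition of subsumption; its strict part is the quantifier case of
  \<open>lang_le\<close>.\<close>

definition quantifier_le :: "quantifier \<Rightarrow> quantifier \<Rightarrow> bool" where
  "quantifier_le q q' \<longleftrightarrow> q = Forall \<or> q' = Exists"

lemma ordered_carrier_quantifier_le: "ordered_carrier UNIV quantifier_le"
  by unfold_locales (auto simp: quantifier_le_def intro: quantifier.exhaust)

text \<open>Such a language is the product of the quantifier chain and the system of bodies:
  subsumption is componentwise, and the order is lexicographic with the quantifier first.\<close>

lemma canon_lang_LExistsForall:
  assumes "canon_lang ord L" "bounded_lang \<Sigma> V (LExistsForall X L)"
  shows "canon_lang ord (LExistsForall X L)"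
proof -
  interpret canon_system "formulas L" "block_sub X L" "lang_le ord L" "block_canon ord X L"
    by (rule canon_system_block) (use assms in auto)
  let ?L = "LExistsForall X L" and ?Q = "\<lambda>p. Quant (fst p) X (snd p)"
  have sub: "subsumes ?L (Quant q1 X1 \<phi>) (Quant q2 X2 \<psi>) \<longleftrightarrow> block_sub X L \<phi> \<psi> \<and> quantifier_le q1 q2"
    for q1 X1 q2 X2 \<phi> \<psi>
    by (simp add: block_sub_def quantifier_le_def)
  have canon: "canon ord ?L (Quant q1 X1 \<phi>) = Quant q1 X1 (block_canon ord X L \<phi>)" for q1 X1 \<phi>
    by (simp add: block_canon_def)
  have le: "lang_le ord ?L (Quant q1 X1 \<phi>) (Quant q2 X2 \<psi>)
      \<longleftrightarrow> strict quantifier_le q1 q2 \<or> q1 = q2 \<and> lang_le ord L \<phi> \<psi>" for q1 X1 q2 X2 \<phi> \<psi>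
    by (cases q1; cases q2) (auto simp: strict_def quantifier_le_def)
  have formulas: "formulas ?L = ?Q ` (UNIV \<times> formulas L)" by (force simp: image_iff)
  interpret Q: ordered_carrier UNIV quantifier_le by (rule ordered_carrier_quantifier_le)
  show ?thesis
    unfolding formulas
  proof (rule canon_systemI[where S = "?Q ` (UNIV \<times> C)"])
    show "ordered_carrier (?Q ` (UNIV \<times> C)) (lang_le ord ?L)"
      by (rule ordered_carrier_image[OF ordered_carrier_lex_prod[OF Q.ordered_carrier_axioms
            ordered_carrier_axioms]]) (simp only: le)
  next
    fix x y z assume "x \<in> ?Q ` (UNIV \<times> formulas L)" "y \<in> ?Q ` (UNIV \<times> formulas L)"
      "z \<in> ?Q ` (UNIV \<times> formulas L)" and xyz: "subsumes ?L x y" "subsumes ?L y z"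
    then obtain q1 \<phi>1 q2 \<phi>2 q3 \<phi>3 where *: "x = Quant q1 X \<phi>1" "y = Quant q2 X \<phi>2" "z = Quant q3 X \<phi>3"
      "\<phi>1 \<in> formulas L" "\<phi>2 \<in> formulas L" "\<phi>3 \<in> formulas L" by force
    show "subsumes ?L x z"
      using xyz sub_trans[OF *(4-6)] Q.le_trans[of q1 q2 q3] unfolding *(1-3) sub by blast
  next
    fix x assume "x \<in> ?Q ` (UNIV \<times> formulas L)"
    then obtain q \<phi> where *: "x = Quant q X \<phi>" "\<phi> \<in> formulas L" by force
    have "canon ord ?L x = ?Q (q, block_canon ord X L \<phi>)" unfolding *(1) canon by simp
    then show "canon ord ?L x \<in> ?Q ` (UNIV \<times> C)" using c_in_C[OF *(2)] by blast
  next
    fix x y assume "x \<in> ?Q ` (UNIV \<times> C)" "y \<in> ?Q ` (UNIV \<times> C)" "subsumes ?L x y"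
    then show "lang_le ord ?L x y"
      using sub_imp_le
      by (auto simp: sub le strict_def simp del: subsumes.simps lang_le.simps)
  qed (auto simp: sub canon sub_refl c_sub sub_c Q.le_refl simp del: subsumes.simps canon.simps)
qed

section \<open>Assembly over all bounded languages\<close>

lemma canon_lang_bounded:
  assumes "valid_base_order \<Sigma> V ord" and "bounded_lang \<Sigma> V L"
  shows "canon_lang ord L"
  using assms(2)
proof (induction L)
  case (LBase A)
  then show ?case by (intro canon_lang_LBase[OF _ assms(1)]) simp
next
  case (LBin c L1 L2)
  then show ?case by (intro canon_lang_LBin) simp_all
next
  case (LBigOr k L)
  then show ?case by (intro canon_lang_LBigOr) simp
next
  case (LBigAnd L)
  then show ?case by (intro canon_lang_LBigAnd) simp
next
  case (LQuant q X L)
  then show ?case by (intro canon_lang_LQuant[of _ _ \<Sigma> V]) simp_all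
next
  case (LExistsForall X L)
  then show ?case by (intro canon_lang_LExistsForall[of _ _ \<Sigma> V]) simp_all
qed

theorem theorem2:
  fixes \<Sigma> :: "('f, 'p) signature" and V :: "'v set"
    and L :: "('f, 'p, 'v) lang" and ord :: "('f, 'p, 'v) base_order"
  assumes "bounded_lang \<Sigma> V L"
    and "valid_base_order \<Sigma> V ord"
  shows "canonicalization (formulas L) (subs_equiv L) (canon ord L)
    \<and> partial_order_on (canonical ord L) (rel_on (canonical ord L) (subsumes L))
    \<and> linear_order_on (canonical ord L) (rel_on (canonical ord L) (lang_le ord L))
    \<and> rel_on (canonical ord L) (subsumes L) \<subseteq> rel_on (canonical ord L) (lang_le ord L)"
proof -
  let ?F = "formulas L" and ?R = "subsumes L" and ?le = "lang_le ord L" and ?c = "canon ord L"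
  interpret canon_system ?F ?R ?le ?c using canon_lang_bounded[OF assms(2,1)] .
  have C: "canonical ord L = C" by (simp add: canonical_def)
  \<comment> \<open>\<open>\<phi>\<close> subsumes the common canonical form, which subsumes
    \<open>\<psi>\<close>; by symmetry this yields equivalence from equality of canonical
    forms.\<close>
  have "?R \<phi> \<psi>" if "\<phi> \<in> ?F" "\<psi> \<in> ?F" "?c \<phi> = ?c \<psi>" for \<phi> \<psi>
    using sub_trans[of \<phi> "?c \<phi>" \<psi>] that c_closed[of \<phi>] sub_c[of \<phi>] c_sub[of \<psi>] by simp
  then have "canonicalization ?F (subs_equiv L) ?c"
    unfolding canonicalization_def subs_equiv_def
    using c_closed c_sub sub_c c_cong by metis
  moreover have "partial_order_on C (rel_on C ?R)"
    unfolding order_on_defs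
  proof (intro conjI)
    show "trans (rel_on C ?R)"
      by (rule transI) (use sub_trans in \<open>unfold rel_on_def, blast\<close>)
    show "antisym (rel_on C ?R)"
      by (rule antisymI) (use sub_antisym in \<open>unfold rel_on_def, blast\<close>)
  qed (use sub_refl in \<open>auto simp: rel_on_def refl_on_def\<close>)
  moreover have "linear_order_on C (rel_on C ?le)"
    unfolding order_on_defs
  proof (intro conjI)
    show "trans (rel_on C ?le)"
      by (rule transI) (use le_trans in \<open>unfold rel_on_def, blast\<close>)
    show "antisym (rel_on C ?le)"
      by (rule antisymI) (use le_antisym in \<open>unfold rel_on_def, blast\<close>)
    show "total_on C (rel_on C ?le)"
      by (rule total_onI) (use le_total in \<open>unfold rel_on_def, blast\<close>)
  qed (use le_refl in \<open>auto simp: rel_on_def refl_on_def\<close>)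
  moreover have "rel_on C ?R \<subseteq> rel_on C ?le"
    using sub_imp_le by (auto simp: rel_on_def)
  ultimately show ?thesis unfolding C by blast
qed

end
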